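(* Let $(\mathcal{A},e)$ be an order-unit space and let $L$ be a Lip-norm on $\mathcal{A}$ which is closed. Let $\tilde{\mathcal{A}}=\mathcal{A}/\mathbb{R}e$ with quotient norm $\|\cdot\|^{\sim}$, let $\tilde L$ be the norm on $\tilde{\mathcal{A}}$ induced by $L$ (i.e. $\tilde L(\tilde a)=L(a)$), and let $\mathcal{K}=\{\tilde a\in\tilde{\mathcal{A}}:\tilde L(\tilde a)\le 1\}$. Then $\mathcal{K}$ is a compact convex set for $\|\cdot\|^{\sim}$, and, letting $Af_0(\mathcal{K})$ denote the Banach space of all $\|\cdot\|^{\sim}$-continuous affine real functions on $\mathcal{K}$ taking the value $0$ at $0$, equipped with the supremum norm, the map $\sigma$ defined by $\sigma(\tilde a)(f)=f(\tilde a)$ is an isometric isomorphism of the normed space $(\tilde{\mathcal{A}},\tilde L)$ onto the Banach space dual of $Af_0(\mathcal{K})$.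
   Context: An order-unit space is a real partially ordered vector space $\mathcal{A}$ with a distinguished element $e$ such that (i) for each $a$ there is $r\in\mathbb{R}$ with $a\le re$, and (ii) if $a\le re$ for all $r>0$ then $a\le 0$; it carries the norm $\|a\|=\inf\{r\ge0:-re\le a\le re\}$ and need not be complete. The quotient norm on $\mathcal{A}/\mathbb{R}e$ is $\|\tilde a\|^{\sim}=\inf_{t\in\mathbb{R}}\|a+te\|$. A seminorm $L$ is lower semicontinuous if $\{a: L(a)\le 1\}$ is norm-closed in $\mathcal{A}$. A Lip-norm on $\mathcal{A}$ is a finite-valued seminorm $L$ on $\mathcal{A}$ such that: (1) $L(a)=0$ iff $a\in\mathbb{R}e$; (2) $L$ is lower semicontinuous; (3) the image of $\{a\in\mathcal{A}: L(a)\le1\}$ in $\mathcal{A}/\mathbb{R}e$ is totally bounded for $\|\cdot\|^{\sim}$. $L$ is closed if $\{a\in\mathcal{A}:L(a)\le 1\}$ is complete for the metric from $\|\cdot\|$. *)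

theory Defs
  imports Complex_Main
begin

definition ou_space :: "'a::ordered_real_vector \<Rightarrow> bool" where
  "ou_space e \<longleftrightarrow>
     (\<forall>a. \<exists>r::real. a \<le> r *\<^sub>R e) \<and>
     (\<forall>a. (\<forall>r::real. r > 0 \<longrightarrow> a \<le> r *\<^sub>R e) \<longrightarrow> a \<le> 0)"

definition ou_norm :: "'a::ordered_real_vector \<Rightarrow> 'a \<Rightarrow> real" where
  "ou_norm e a = Inf {r. 0 \<le> r \<and> - (r *\<^sub>R e) \<le> a \<and> a \<le> r *\<^sub>R e}"

definition ou_seminorm :: "('a::real_vector \<Rightarrow> real) \<Rightarrow> bool" where
  "ou_seminorm L \<longleftrightarrow>
     (\<forall>a b. L (a + b) \<le> L a + L b) \<and> (\<forall>r a. L (r *\<^sub>R a) = \<bar>r\<bar> * L a)"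

text \<open>Lower semicontinuity: the set of a with L a at most 1 is closed for ou_norm
  (sequentially closed, which is the same as closed in a (semi)metric space).\<close>
definition ou_lsc :: "'a::ordered_real_vector \<Rightarrow> ('a \<Rightarrow> real) \<Rightarrow> bool" where
  "ou_lsc e L \<longleftrightarrow>
     (\<forall>x a. (\<forall>n. L (x n) \<le> 1) \<longrightarrow> (\<lambda>n. ou_norm e (x n - a)) \<longlonglongrightarrow> 0 \<longrightarrow> L a \<le> 1)"

definition q_norm :: "'a::ordered_real_vector \<Rightarrow> 'a \<Rightarrow> real" where
  "q_norm e a = Inf (range (\<lambda>t::real. ou_norm e (a + t *\<^sub>R e)))"

definition ou_tot_bdd :: "'a::ordered_real_vector \<Rightarrow> ('a \<Rightarrow> real) \<Rightarrow> bool" where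
  "ou_tot_bdd e L \<longleftrightarrow>
     (\<forall>\<epsilon>>0. \<exists>F. finite F \<and> (\<forall>b\<in>F. L b \<le> 1) \<and>
        (\<forall>a. L a \<le> 1 \<longrightarrow> (\<exists>b\<in>F. q_norm e (a - b) < \<epsilon>)))"

definition Lip_norm :: "'a::ordered_real_vector \<Rightarrow> ('a \<Rightarrow> real) \<Rightarrow> bool" where
  "Lip_norm e L \<longleftrightarrow>
     ou_seminorm L \<and> (\<forall>a. L a = 0 \<longleftrightarrow> (\<exists>t::real. a = t *\<^sub>R e)) \<and>
     ou_lsc e L \<and> ou_tot_bdd e L"

definition Lip_closed :: "'a::ordered_real_vector \<Rightarrow> ('a \<Rightarrow> real) \<Rightarrow> bool" where
  "Lip_closed e L \<longleftrightarrow>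
     (\<forall>x. (\<forall>n. L (x n) \<le> 1) \<longrightarrow>
          (\<forall>\<epsilon>>0. \<exists>N. \<forall>m\<ge>N. \<forall>n\<ge>N. ou_norm e (x m - x n) < \<epsilon>) \<longrightarrow>
          (\<exists>a. L a \<le> 1 \<and> (\<lambda>n. ou_norm e (x n - a)) \<longlonglongrightarrow> 0))"

definition coset :: "'a::real_vector \<Rightarrow> 'a \<Rightarrow> 'a set" where
  "coset e a = {a + t *\<^sub>R e | t::real. True}"

definition Qt :: "'a::real_vector \<Rightarrow> 'a set set" where
  "Qt e = range (coset e)"

definition rep :: "'a set \<Rightarrow> 'a" where
  "rep C = (SOME a. a \<in> C)"

definition qzero :: "'a::real_vector \<Rightarrow> 'a set" where
  "qzero e = coset e 0"

definition qadd :: "'a::real_vector \<Rightarrow> 'a set \<Rightarrow> 'a set \<Rightarrow> 'a set" where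
  "qadd e C D = coset e (rep C + rep D)"

definition qscale :: "'a::real_vector \<Rightarrow> real \<Rightarrow> 'a set \<Rightarrow> 'a set" where
  "qscale e r C = coset e (r *\<^sub>R rep C)"

definition qnormC :: "'a::ordered_real_vector \<Rightarrow> 'a set \<Rightarrow> real" where
  "qnormC e C = Inf (ou_norm e ` C)"

definition qdist :: "'a::ordered_real_vector \<Rightarrow> 'a set \<Rightarrow> 'a set \<Rightarrow> real" where
  "qdist e C D = qnormC e (qadd e C (qscale e (-1) D))"

definition Lt :: "('a \<Rightarrow> real) \<Rightarrow> 'a set \<Rightarrow> real" where
  "Lt L C = L (rep C)"

definition Kset :: "'a::ordered_real_vector \<Rightarrow> ('a \<Rightarrow> real) \<Rightarrow> 'a set set" where
  "Kset e L = {C \<in> Qt e. Lt L C \<le> 1}"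

definition q_compact :: "'a::ordered_real_vector \<Rightarrow> 'a set set \<Rightarrow> bool" where
  "q_compact e K \<longleftrightarrow>
     (\<forall>X::nat \<Rightarrow> 'a set. (\<forall>n. X n \<in> K) \<longrightarrow>
        (\<exists>r C. strict_mono r \<and> C \<in> K \<and> (\<lambda>n. qdist e (X (r n)) C) \<longlonglongrightarrow> 0))"

definition q_convex :: "'a::ordered_real_vector \<Rightarrow> 'a set set \<Rightarrow> bool" where
  "q_convex e K \<longleftrightarrow>
     (\<forall>C\<in>K. \<forall>D\<in>K. \<forall>u::real. 0 \<le> u \<and> u \<le> 1 \<longrightarrow>
        qadd e (qscale e u C) (qscale e (1 - u) D) \<in> K)"

text \<open>Continuous affine real functions on K vanishing at 0; to obtain a genuine space
  of functions they are normalised to be 0 off K.\<close>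
definition Af0 :: "'a::ordered_real_vector \<Rightarrow> 'a set set \<Rightarrow> ('a set \<Rightarrow> real) set" where
  "Af0 e K = {f.
     (\<forall>C. C \<notin> K \<longrightarrow> f C = 0) \<and>
     (\<forall>C\<in>K. \<forall>D\<in>K. \<forall>u::real. 0 \<le> u \<and> u \<le> 1 \<longrightarrow>
        f (qadd e (qscale e u C) (qscale e (1 - u) D)) = u * f C + (1 - u) * f D) \<and>
     (\<forall>C\<in>K. \<forall>\<epsilon>>0. \<exists>\<delta>>0. \<forall>D\<in>K. qdist e D C < \<delta> \<longrightarrow> \<bar>f D - f C\<bar> < \<epsilon>) \<and>
     f (qzero e) = 0}"

definition supnorm :: "'b set \<Rightarrow> ('b \<Rightarrow> real) \<Rightarrow> real" where
  "supnorm K f = Sup ((\<lambda>C. \<bar>f C\<bar>) ` K)"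

definition dual_space :: "'a::ordered_real_vector \<Rightarrow> 'a set set \<Rightarrow> (('a set \<Rightarrow> real) \<Rightarrow> real) set" where
  "dual_space e K = {\<phi>.
     (\<forall>f\<in>Af0 e K. \<forall>g\<in>Af0 e K. \<phi> (\<lambda>C. f C + g C) = \<phi> f + \<phi> g) \<and>
     (\<forall>f\<in>Af0 e K. \<forall>r::real. \<phi> (\<lambda>C. r * f C) = r * \<phi> f) \<and>
     (\<exists>B. \<forall>f\<in>Af0 e K. \<bar>\<phi> f\<bar> \<le> B * supnorm K f)}"

definition dual_norm :: "'a::ordered_real_vector \<Rightarrow> 'a set set \<Rightarrow> (('a set \<Rightarrow> real) \<Rightarrow> real) \<Rightarrow> real" where
  "dual_norm e K \<phi> = Sup {\<bar>\<phi> f\<bar> | f. f \<in> Af0 e K \<and> supnorm K f \<le> 1}"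

text \<open>The map sigma: sigma(a~)(f) = f(a~), where f is extended from the unit ball K of
  (Qt, Lt) to the whole quotient by positive homogeneity (its unique linear extension).\<close>
definition sigma :: "'a::ordered_real_vector \<Rightarrow> ('a \<Rightarrow> real) \<Rightarrow> 'a set \<Rightarrow> ('a set \<Rightarrow> real) \<Rightarrow> real" where
  "sigma e L C f = (if Lt L C = 0 then 0 else Lt L C * f (qscale e (1 / Lt L C) C))"

end

theory Submission
  imports Defs "HOL-Analysis.Abstract_Metric_Spaces"
begin

text \<open>Two obstacles shape the proof. First, \<open>ou_space e\<close> admits units that are
  not positive, for which \<open>ou_norm e\<close> is no norm. The duality argument is therefore
  phrased without the order: the locales \<open>lsc_quotient\<close> and
  \<open>compact_quotient\<close> record the facts about \<open>L\<close> and
  \<open>q_norm e\<close> that it uses, and the positive and the non-positive unit reach these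
  locales by separate routes. Second, an element of \<open>Af0\<close> must be continuous for
  \<open>q_norm e\<close>, while a Hahn-Banach functional dominated by \<open>L\<close> alone need
  not be. The functional is therefore sought below \<open>L\<close> and below a multiple of
  \<open>q_norm e\<close> at once; the price is that only values below \<open>L a\<close> are
  reached, which is enough for a supremum. Moreover, an element of \<open>Af0\<close> lives on
  \<open>K\<close> only. The definition of \<open>sigma\<close> extends it by positive homogeneity,
  so additivity of the extension has to be earned from affinity by rescaling into
  \<open>K\<close>.\<close>

text \<open>Everything rests on two facts: the Lip-norm \<open>L\<close> is lower semicontinuous for the quotient
  norm, and its unit ball \<open>K\<close> is compact for that norm (by total boundedness and closedness, a
  Cauchy sequence in the quotient being lifted to a Cauchy sequence in the space).
  An element of \<open>Af\<^sub>0(K)\<close> extends to a linear functional bounded by its supremum norm times \<open>L\<close>,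
  which gives \<open>\<parallel>\<sigma>(a)\<parallel> \<le> L a\<close>; lower semicontinuity and Hahn--Banach give the converse.
  For surjectivity, every functional of norm at most 1 on \<open>Af\<^sub>0(K)\<close> agrees on each finite set with
  evaluation at a point of \<open>K\<close>, and compactness of \<open>K\<close> provides a common point for all finite sets.\<close>

section \<open>Hahn--Banach for sublinear functionals\<close>

definition sublinear :: "('a::real_vector \<Rightarrow> real) \<Rightarrow> bool" where
  "sublinear p \<longleftrightarrow>
     (\<forall>x y. p (x + y) \<le> p x + p y) \<and> (\<forall>r x. 0 \<le> r \<longrightarrow> p (r *\<^sub>R x) = r * p x)"

lemma sublinear_add: "sublinear p \<Longrightarrow> p (x + y) \<le> p x + p y"
  by (simp add: sublinear_def)

lemma sublinear_scale: "sublinear p \<Longrightarrow> 0 \<le> r \<Longrightarrow> p (r *\<^sub>R x) = r * p x"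
  by (simp add: sublinear_def)

lemma sublinear_zero: "sublinear p \<Longrightarrow> p 0 = 0"
  using sublinear_scale[of p 0 0] by simp

lemma sublinear_minus_le: "sublinear p \<Longrightarrow> - p (- x) \<le> p x"
  using sublinear_add[of p x "- x"] by (simp add: sublinear_zero)

text \<open>One inequality yields homogeneity: used for \<open>inverse r\<close> at the scaled
  point, it gives the reverse one.\<close>

lemma sublinearI:
  fixes p :: "'a::real_vector \<Rightarrow> real"
  assumes add: "\<And>x y. p (x + y) \<le> p x + p y" and zero: "p 0 = 0"
    and scale: "\<And>r x. r > 0 \<Longrightarrow> p (r *\<^sub>R x) \<le> r * p x"
  shows "sublinear p"
  unfolding sublinear_def
proof (intro conjI allI impI)
  fix r :: real and x :: 'a
  assume "0 \<le> r"
  show "p (r *\<^sub>R x) = r * p x"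
  proof (cases "r = 0")
    case False
    with \<open>0 \<le> r\<close> have r: "r > 0" by simp
    have "p x \<le> inverse r * p (r *\<^sub>R x)"
      using scale[of "inverse r" "r *\<^sub>R x"] r by simp
    then have "r * p x \<le> p (r *\<^sub>R x)"
      using r by (simp add: field_simps)
    then show ?thesis using scale[OF r, of x] by simp
  qed (simp add: zero)
qed (rule add)

text \<open>The common core of the subadditivity proofs for functionals given by infima:
  \<open>flatten\<close>, infima of chains, \<open>inf_conv\<close>, \<open>ou_norm\<close> and
  \<open>q_norm\<close>.\<close>

lemma le_cINF_add:
  fixes f g :: "'b \<Rightarrow> real"
  assumes "A \<noteq> {}" "B \<noteq> {}" "\<And>a b. a \<in> A \<Longrightarrow> b \<in> B \<Longrightarrow> c \<le> f a + g b"
  shows "c \<le> Inf (f ` A) + Inf (g ` B)"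
proof -
  have "c - f a \<le> Inf (g ` B)" if "a \<in> A" for a
    using assms that by (intro cINF_greatest) (auto simp: algebra_simps)
  then have "c - Inf (g ` B) \<le> Inf (f ` A)"
    using assms by (intro cINF_greatest) (auto simp: algebra_simps)
  then show ?thesis by simp
qed

lemma le_mult_cINF:
  fixes f :: "'b \<Rightarrow> real"
  assumes "A \<noteq> {}" "r > 0" "\<And>a. a \<in> A \<Longrightarrow> c \<le> r * f a"
  shows "c \<le> r * Inf (f ` A)"
proof -
  have "c / r \<le> Inf (f ` A)"
    using assms by (intro cINF_greatest) (auto simp: field_simps)
  then show ?thesis using assms by (simp add: field_simps)
qed

text \<open>The largest sublinear functional below \<open>p\<close> whose value at \<open>- v\<close> is at most \<open>- p v\<close>.\<close>

definition flatten :: "('a::real_vector \<Rightarrow> real) \<Rightarrow> 'a \<Rightarrow> 'a \<Rightarrow> real" where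
  "flatten p v x = Inf ((\<lambda>t. p (x + t *\<^sub>R v) - t * p v) ` {0..})"

lemma flatten_le:
  assumes "sublinear p" "0 \<le> t"
  shows "flatten p v x \<le> p (x + t *\<^sub>R v) - t * p v"
  unfolding flatten_def
proof (rule cINF_lower)
  \<comment> \<open>The bound must not depend on \<open>t\<close>; it comes from
    \<open>t * p v = p (t v) \<le> p (x + t v) + p (- x)\<close>.\<close>
  show "bdd_below ((\<lambda>t. p (x + t *\<^sub>R v) - t * p v) ` {0..})"
  proof (rule bdd_belowI2)
    fix t :: real assume "t \<in> {0..}"
    then show "- p (- x) \<le> p (x + t *\<^sub>R v) - t * p v"
      using sublinear_add[OF assms(1), of "x + t *\<^sub>R v" "- x"]
        sublinear_scale[OF assms(1), of t v] by simp
  qed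
qed (use assms in auto)

lemma sublinear_flatten:
  assumes p: "sublinear p"
  shows "sublinear (flatten p v)"
proof (rule sublinearI)
  fix x y
  show "flatten p v (x + y) \<le> flatten p v x + flatten p v y"
    unfolding flatten_def[of p v x] flatten_def[of p v y]
  proof (rule le_cINF_add)
    fix s t :: real assume "s \<in> {0..}" "t \<in> {0..}"
    then show "flatten p v (x + y)
        \<le> (p (x + s *\<^sub>R v) - s * p v) + (p (y + t *\<^sub>R v) - t * p v)"
      using flatten_le[OF p, of "s + t" v "x + y"]
        sublinear_add[OF p, of "x + s *\<^sub>R v" "y + t *\<^sub>R v"]
      by (simp add: algebra_simps)
  qed auto
next
  have "(\<lambda>t. p (0 + t *\<^sub>R v) - t * p v) ` {0..} = {0}"
    using sublinear_scale[OF p] by (force simp: image_iff)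
  then show "flatten p v 0 = 0" by (simp add: flatten_def)
next
  fix r :: real and x assume r: "r > 0"
  show "flatten p v (r *\<^sub>R x) \<le> r * flatten p v x"
    unfolding flatten_def[of p v x]
  proof (rule le_mult_cINF)
    fix t :: real assume "t \<in> {0..}"
    then show "flatten p v (r *\<^sub>R x) \<le> r * (p (x + t *\<^sub>R v) - t * p v)"
      using flatten_le[OF p, of "r * t" v "r *\<^sub>R x"] sublinear_scale[OF p, of r "x + t *\<^sub>R v"] r
      by (simp add: algebra_simps)
  qed (use r in auto)
qed

text \<open>Taking \<open>t = 0\<close> puts \<open>flatten p v\<close> below \<open>p\<close>, so
  minimality makes them equal; \<open>t = 1\<close> then reads
  \<open>p x \<le> p (x + v) - p v\<close>, the missing half of additivity.\<close>

lemma minimal_sublinear_linear: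
  assumes p: "sublinear p" and min: "\<And>q. sublinear q \<Longrightarrow> q \<le> p \<Longrightarrow> q = p"
  shows "linear p"
proof -
  have add: "p (x + v) = p x + p v" for x v
  proof -
    have "flatten p v \<le> p"
      using flatten_le[OF p, of 0 v] by (simp add: le_fun_def)
    then have "flatten p v = p" using min sublinear_flatten[OF p] by blast
    then show ?thesis
      using flatten_le[OF p, of 1 v x] sublinear_add[OF p, of x v] by simp
  qed
  have neg: "p (- x) = - p x" for x
    using add[of x "- x"] by (simp add: sublinear_zero[OF p])
  show ?thesis
  proof (rule linearI)
    fix r :: real and x
    show "p (r *\<^sub>R x) = r *\<^sub>R p x"
    proof (cases "0 \<le> r")
      case False
      then show ?thesis
        using sublinear_scale[OF p, of "- r" x] neg[of "r *\<^sub>R x"] by simp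
    qed (simp add: sublinear_scale[OF p])
  qed (rule add)
qed

lemma exists_minimal_sublinear:
  assumes p: "sublinear p"
  obtains m where "sublinear m" "m \<le> p" "\<And>q. sublinear q \<Longrightarrow> q \<le> m \<Longrightarrow> q = m"
proof -
  define S where "S = {q. sublinear q \<and> q \<le> p}"
  have "\<exists>m\<in>S. \<forall>a\<in>S. m \<ge> a \<longrightarrow> a = m"
  proof (rule predicate_Zorn)
    show "partial_order_on S (relation_of (\<ge>) S)"
      by (auto intro!: partial_order_on_relation_ofI)
  next
    fix C assume "C \<in> Chains (relation_of (\<ge>) S)"
    then have C: "q \<in> S" "q' \<in> S" "q \<le> q' \<or> q' \<le> q" if "q \<in> C" "q' \<in> C" for q q'
      using that unfolding Chains_def relation_of_def by auto
    show "\<exists>u\<in>S. \<forall>a\<in>C. a \<ge> u"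
    proof (cases "C = {}")
      case True
      then show ?thesis using p by (auto simp: S_def)
    next
      case False
      define u where "u x = Inf ((\<lambda>q. q x) ` C)" for x
      have sub: "sublinear q" if "q \<in> C" for q using C that by (auto simp: S_def)
      have le: "u x \<le> q x" if "q \<in> C" for q x
        unfolding u_def
      proof (rule cINF_lower)
        show "bdd_below ((\<lambda>q. q x) ` C)"
        proof (rule bdd_belowI2)
          fix q assume "q \<in> C"
          then have "sublinear q" "q (- x) \<le> p (- x)"
            using C by (auto simp: S_def le_fun_def)
          then show "- p (- x) \<le> q x"
            using sublinear_minus_le[of q x] by simp
        qed
      qed (rule that)
      have "sublinear u"
      proof (rule sublinearI)
        fix x y
        show "u (x + y) \<le> u x + u y"
          unfolding u_def[of x] u_def[of y]
        proof (rule le_cINF_add)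
          \<comment> \<open>An infimum of arbitrary sublinear functionals need not be subadditive;
            in a chain the smaller of \<open>q\<close> and \<open>q'\<close> serves for both
            summands.\<close>
          fix q q' assume q: "q \<in> C" "q' \<in> C"
          from C(3)[OF q] show "u (x + y) \<le> q x + q' y"
          proof
            assume "q \<le> q'"
            then have "q y \<le> q' y" by (simp add: le_fun_def)
            then show ?thesis
              using le[OF q(1), of "x + y"] sublinear_add[OF sub[OF q(1)], of x y] by simp
          next
            assume "q' \<le> q"
            then have "q' x \<le> q x" by (simp add: le_fun_def)
            then show ?thesis
              using le[OF q(2), of "x + y"] sublinear_add[OF sub[OF q(2)], of x y] by simp
          qed
        qed (use False in auto)
      next
        have "(\<lambda>q. q 0) ` C = {0}"
          using False sublinear_zero[OF sub] by (force simp: image_iff)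
        then show "u 0 = 0" by (simp add: u_def)
      next
        fix r :: real and x assume r: "r > 0"
        show "u (r *\<^sub>R x) \<le> r * u x"
          unfolding u_def[of x]
        proof (rule le_mult_cINF)
          fix q assume q: "q \<in> C"
          show "u (r *\<^sub>R x) \<le> r * q x"
            using le[OF q, of "r *\<^sub>R x"] sublinear_scale[OF sub[OF q], of r x] r by simp
        qed (use r False in auto)
      qed
      moreover from False obtain q where "q \<in> C" by blast
      then have "u \<le> p"
        using le[of q] C(1)[of q q] by (fastforce simp: S_def le_fun_def intro: order_trans)
      ultimately show ?thesis using le by (auto simp: S_def le_fun_def)
    qed
  qed
  then obtain m where m: "m \<in> S" "\<And>a. a \<in> S \<Longrightarrow> a \<le> m \<Longrightarrow> a = m" by blast
  show thesis
  proof (rule that)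
    show "q = m" if "sublinear q" "q \<le> m" for q
      using m that by (auto simp: S_def intro: order_trans)
  qed (use m in \<open>auto simp: S_def\<close>)
qed

text \<open>Minimality is taken below \<open>flatten p v\<close> instead of \<open>p\<close>: at
  \<open>- v\<close> with \<open>t = 1\<close> this forces \<open>f (- v) \<le> - p v\<close>, so
  \<open>f\<close> attains \<open>p\<close> at \<open>v\<close>.\<close>

theorem Hahn_Banach_sublinear:
  fixes p :: "'a::real_vector \<Rightarrow> real"
  assumes p: "sublinear p"
  obtains f where "linear f" "\<And>x. f x \<le> p x" "f v = p v"
proof -
  obtain f where f: "sublinear f" "f \<le> flatten p v" "\<And>q. sublinear q \<Longrightarrow> q \<le> f \<Longrightarrow> q = f"
    using exists_minimal_sublinear[OF sublinear_flatten[OF p]] by blast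
  have lin: "linear f" by (rule minimal_sublinear_linear[OF f(1) f(3)])
  have le: "f x \<le> p x" for x
    using f(2) flatten_le[OF p, of 0 v x] by (auto simp: le_fun_def intro: order_trans)
  have "f (- v) \<le> - p v"
    using f(2) flatten_le[OF p, of 1 v "- v"] sublinear_zero[OF p]
    by (auto simp: le_fun_def intro: order_trans)
  then have "f v = p v"
    using le[of v] linear_neg[OF lin, of v] by simp
  with lin le show thesis by (rule that)
qed

section \<open>Seminorms, infimal convolution and separation\<close>

lemma seminorm_add: "ou_seminorm L \<Longrightarrow> L (a + b) \<le> L a + L b"
  by (simp add: ou_seminorm_def)

lemma seminorm_scale: "ou_seminorm L \<Longrightarrow> L (r *\<^sub>R a) = \<bar>r\<bar> * L a"
  by (simp add: ou_seminorm_def)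

lemma sublinear_even_imp_seminorm:
  assumes sub: "sublinear p" and even: "\<And>x. p (- x) = p x"
  shows "ou_seminorm p"
proof -
  have "p (r *\<^sub>R x) = \<bar>r\<bar> * p x" for r x
    using sublinear_scale[OF sub, of r x] sublinear_scale[OF sub, of "- r" x] even[of "r *\<^sub>R x"]
    by (cases "0 \<le> r") auto
  then show ?thesis using sublinear_add[OF sub] by (simp add: ou_seminorm_def)
qed

lemma seminorm_zero: "ou_seminorm L \<Longrightarrow> L 0 = 0"
  using seminorm_scale[of L 0 0] by simp

lemma seminorm_minus: "ou_seminorm L \<Longrightarrow> L (- a) = L a"
  using seminorm_scale[of L "-1" a] by simp

lemma seminorm_diff: "ou_seminorm L \<Longrightarrow> L (a - b) \<le> L a + L b"
  using seminorm_add[of L a "- b"] by (simp add: seminorm_minus)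

lemma seminorm_diff_commute: "ou_seminorm L \<Longrightarrow> L (a - b) = L (b - a)"
  using seminorm_minus[of L "b - a"] by simp

lemma seminorm_nonneg: "ou_seminorm L \<Longrightarrow> 0 \<le> L a"
  using seminorm_diff[of L a a] by (simp add: seminorm_zero)

lemma seminorm_triangle: "ou_seminorm L \<Longrightarrow> L (a - c) \<le> L (a - b) + L (b - c)"
  using seminorm_add[of L "a - b" "b - c"] by simp

text \<open>For seminorms this is the largest sublinear functional below both \<open>p\<close> and
  \<open>q\<close>, hence the right majorant for a functional that must obey two bounds.\<close>

definition inf_conv :: "('a::real_vector \<Rightarrow> real) \<Rightarrow> ('a \<Rightarrow> real) \<Rightarrow> 'a \<Rightarrow> real" where
  "inf_conv p q x = Inf (range (\<lambda>y. p y + q (x - y)))"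

lemma inf_conv_le:
  assumes "ou_seminorm p" "ou_seminorm q"
  shows "inf_conv p q x \<le> p y + q (x - y)"
  unfolding inf_conv_def
  by (rule cINF_lower)
    (auto intro!: bdd_belowI2[where m = 0] add_nonneg_nonneg seminorm_nonneg[OF assms(1)] seminorm_nonneg[OF assms(2)])

lemma sublinear_inf_conv:
  assumes "ou_seminorm p" "ou_seminorm q"
  shows "sublinear (inf_conv p q)"
proof (rule sublinearI)
  fix x y
  show "inf_conv p q (x + y) \<le> inf_conv p q x + inf_conv p q y"
    unfolding inf_conv_def[of p q x] inf_conv_def[of p q y]
  proof (rule le_cINF_add)
    fix s t
    show "inf_conv p q (x + y) \<le> (p s + q (x - s)) + (p t + q (y - t))"
      using inf_conv_le[OF assms, of "x + y" "s + t"] seminorm_add[OF assms(1), of s t]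
        seminorm_add[OF assms(2), of "x - s" "y - t"]
      by (simp add: algebra_simps)
  qed auto
next
  have "0 \<le> inf_conv p q 0"
    unfolding inf_conv_def
    by (rule cINF_greatest) (auto intro!: add_nonneg_nonneg seminorm_nonneg[OF assms(1)] seminorm_nonneg[OF assms(2)])
  then show "inf_conv p q 0 = 0"
    using inf_conv_le[OF assms, of 0 0] by (simp add: seminorm_zero assms)
next
  fix r :: real and x assume r: "r > 0"
  show "inf_conv p q (r *\<^sub>R x) \<le> r * inf_conv p q x"
    unfolding inf_conv_def[of p q x]
  proof (rule le_mult_cINF)
    fix y
    show "inf_conv p q (r *\<^sub>R x) \<le> r * (p y + q (x - y))"
      using inf_conv_le[OF assms, of "r *\<^sub>R x" "r *\<^sub>R y"] r
        seminorm_scale[OF assms(1), of r y] seminorm_scale[OF assms(2), of r "x - y"]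
      by (simp add: algebra_simps)
  qed (use r in auto)
qed

text \<open>Separation in Hahn--Banach form: the functional is dominated by the infimal convolution
  of \<open>p\<close> with a large multiple of \<open>q\<close>, whose value at \<open>v\<close> tends to \<open>p v\<close>.\<close>

lemma separating_functional:
  fixes p q :: "'a::real_vector \<Rightarrow> real"
  assumes p: "ou_seminorm p" and q: "ou_seminorm q"
    and lsc: "\<And>y r. (\<And>n::nat. p (y n) \<le> r) \<Longrightarrow> (\<lambda>n. q (y n - v)) \<longlonglongrightarrow> 0 \<Longrightarrow> p v \<le> r"
    and r: "r < p v"
  obtains f M where "linear f" "\<And>x. \<bar>f x\<bar> \<le> p x" "\<And>x. \<bar>f x\<bar> \<le> M * q x" "r \<le> f v"
proof -
  have qM: "ou_seminorm (\<lambda>x. M * q x)" if "0 \<le> M" for M :: real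
    using that q unfolding ou_seminorm_def
    by (simp add: mult_left_mono flip: distrib_left)
  \<comment> \<open>Otherwise near-optimal decompositions of \<open>v\<close> give points
    \<open>y n\<close> with \<open>p (y n) \<le> r\<close> and, for \<open>n > 0\<close>,
    \<open>q (y n - v) \<le> r / n\<close>, against lower semicontinuity.\<close>
  have "\<exists>n::nat. r \<le> inf_conv p (\<lambda>x. real n * q x) v"
  proof (rule ccontr)
    assume "\<not> ?thesis"
    then have "inf_conv p (\<lambda>x. real n * q x) v < r" for n by (simp add: not_le)
    then have "\<exists>y. p y + real n * q (v - y) < r" for n
      unfolding inf_conv_def[of _ _ v]
      by (subst (asm) cINF_less_iff)
        (auto intro!: bdd_belowI2[where m = 0] add_nonneg_nonneg mult_nonneg_nonneg
          seminorm_nonneg[OF p] seminorm_nonneg[OF q])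
    then obtain y where y: "p (y n) + real n * q (v - y n) < r" for n by metis
    have nn: "0 \<le> p (y n)" "0 \<le> q (v - y n)" for n by (simp_all add: seminorm_nonneg p q)
    have "p (y n) \<le> r" for n
      using y[of n] nn[of n] mult_nonneg_nonneg[of "real n" "q (v - y n)"] by linarith
    moreover have "(\<lambda>n. q (y n - v)) \<longlonglongrightarrow> 0"
    proof (rule tendsto_sandwich[OF _ _ tendsto_const])
      show "\<forall>\<^sub>F n in sequentially. 0 \<le> q (y n - v)" by (simp add: seminorm_nonneg q)
      show "(\<lambda>n. r / real n) \<longlonglongrightarrow> 0" by (rule lim_const_over_n)
      show "\<forall>\<^sub>F n in sequentially. q (y n - v) \<le> r / real n"
        using eventually_gt_at_top[of 0]
      proof eventually_elim
        case (elim n)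
        then show ?case
          using y[of n] nn[of n] seminorm_diff_commute[OF q, of v "y n"] by (simp add: field_simps)
      qed
    qed
    ultimately have "p v \<le> r" by (rule lsc)
    with r show False by simp
  qed
  then obtain n :: nat where n: "r \<le> inf_conv p (\<lambda>x. real n * q x) v" by blast
  let ?g = "inf_conv p (\<lambda>x. real n * q x)"
  have qn: "ou_seminorm (\<lambda>x. real n * q x)" by (rule qM) simp
  obtain f where f: "linear f" "\<And>x. f x \<le> ?g x" "f v = ?g v"
    using Hahn_Banach_sublinear[OF sublinear_inf_conv[OF p qn]] by blast
  have le: "f x \<le> p x" "f x \<le> real n * q x" for x
    using f(2)[of x] inf_conv_le[OF p qn, of x x] inf_conv_le[OF p qn, of x 0]
    by (simp_all add: seminorm_zero p q)
  have neg: "f (- x) = - f x" for x by (rule linear_neg[OF f(1)])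
  show thesis
  proof (rule that)
    show "\<bar>f x\<bar> \<le> p x" "\<bar>f x\<bar> \<le> real n * q x" for x
      using le[of x] le[of "- x"] neg[of x] by (auto simp: seminorm_minus p q)
  qed (use f n in auto)
qed

section \<open>The quotient by the span of \<open>e\<close>\<close>

lemma coset_eq_iff: "coset e a = coset e b \<longleftrightarrow> (\<exists>t. a = b + t *\<^sub>R e)"
proof
  assume "coset e a = coset e b"
  moreover have "a + 0 *\<^sub>R e \<in> coset e a" unfolding coset_def by blast
  ultimately show "\<exists>t. a = b + t *\<^sub>R e" by (simp add: coset_def)
next
  assume "\<exists>t. a = b + t *\<^sub>R e"
  then obtain t where t: "a = b + t *\<^sub>R e" by blast
  have "a + s *\<^sub>R e = b + (s + t) *\<^sub>R e" "b + s *\<^sub>R e = a + (s - t) *\<^sub>R e" for s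
    by (simp_all add: t algebra_simps)
  then show "coset e a = coset e b" unfolding coset_def by (metis (no_types, opaque_lifting))
qed

lemma coset_shift [simp]: "coset e (a + t *\<^sub>R e) = coset e a"
  by (auto simp: coset_eq_iff)

lemma rep_coset: obtains t where "rep (coset e a) = a + t *\<^sub>R e"
proof -
  have "a + 0 *\<^sub>R e \<in> coset e a" unfolding coset_def by blast
  then have "rep (coset e a) \<in> coset e a" unfolding rep_def by (rule someI)
  then show thesis using that by (auto simp: coset_def)
qed

lemma coset_in_Qt [simp]: "coset e a \<in> Qt e"
  by (simp add: Qt_def)

lemma coset_rep: "C \<in> Qt e \<Longrightarrow> coset e (rep C) = C"
  unfolding Qt_def by (metis coset_shift rangeE rep_coset)

lemma qadd_coset: "qadd e (coset e a) (coset e b) = coset e (a + b)"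
proof -
  obtain s t where "rep (coset e a) = a + s *\<^sub>R e" "rep (coset e b) = b + t *\<^sub>R e"
    using rep_coset by metis
  then have "rep (coset e a) + rep (coset e b) = (a + b) + (s + t) *\<^sub>R e"
    by (simp add: algebra_simps)
  then show ?thesis by (simp only: qadd_def coset_shift)
qed

lemma qscale_coset: "qscale e r (coset e a) = coset e (r *\<^sub>R a)"
proof -
  obtain t where "rep (coset e a) = a + t *\<^sub>R e" using rep_coset by metis
  then have "r *\<^sub>R rep (coset e a) = r *\<^sub>R a + (r * t) *\<^sub>R e"
    by (simp add: algebra_simps)
  then show ?thesis by (simp only: qscale_def coset_shift)
qed

lemma qnormC_coset: "qnormC e (coset e a) = q_norm e a"
proof -
  have "ou_norm e ` coset e a = range (\<lambda>t. ou_norm e (a + t *\<^sub>R e))"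
    by (auto simp: coset_def)
  then show ?thesis by (simp add: qnormC_def q_norm_def)
qed

lemma q_norm_shift [simp]: "q_norm e (a + t *\<^sub>R e) = q_norm e a"
  by (metis coset_shift qnormC_coset)

lemma qdist_rep: "qdist e C D = q_norm e (rep C - rep D)"
proof -
  obtain t where "rep (coset e ((-1) *\<^sub>R rep D)) = (-1) *\<^sub>R rep D + t *\<^sub>R e"
    using rep_coset by metis
  then have "rep C + rep (qscale e (-1) D) = (rep C - rep D) + t *\<^sub>R e"
    by (simp add: qscale_def)
  then show ?thesis unfolding qdist_def qadd_def by (simp only: coset_shift qnormC_coset)
qed

lemma qdist_coset: "qdist e (coset e a) (coset e b) = q_norm e (a - b)"
proof -
  obtain s t where "rep (coset e a) = a + s *\<^sub>R e" "rep (coset e b) = b + t *\<^sub>R e"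
    using rep_coset by metis
  then have "rep (coset e a) - rep (coset e b) = (a - b) + (s - t) *\<^sub>R e"
    by (simp add: algebra_simps)
  then show ?thesis by (simp only: qdist_rep q_norm_shift)
qed

text \<open>Lower semicontinuity is required for the quotient norm, whereas \<open>ou_lsc\<close>
  speaks of \<open>ou_norm\<close>; for positive \<open>e\<close>,
  \<open>lsc_quotient_Lip_norm\<close> bridges the two.\<close>

locale lsc_quotient =
  fixes e :: "'a::ordered_real_vector" and L :: "'a \<Rightarrow> real"
  assumes seminorm_L: "ou_seminorm L"
    and kernel_L: "L a = 0 \<longleftrightarrow> (\<exists>t::real. a = t *\<^sub>R e)"
    and seminorm_q: "ou_seminorm (q_norm e)"
    and lsc_q: "(\<And>n::nat. L (y n) \<le> 1) \<Longrightarrow> (\<lambda>n. q_norm e (y n - a)) \<longlonglongrightarrow> 0 \<Longrightarrow> L a \<le> 1"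
begin

abbreviation "K \<equiv> Kset e L"

lemma L_shift [simp]: "L (a + t *\<^sub>R e) = L a"
proof -
  have "L (t *\<^sub>R e) = 0" for t using kernel_L by blast
  then show ?thesis
    using seminorm_add[OF seminorm_L, of a "t *\<^sub>R e"]
      seminorm_diff[OF seminorm_L, of "a + t *\<^sub>R e" "t *\<^sub>R e"] by simp
qed

lemma L_convex:
  assumes "L a \<le> 1" "L b \<le> 1" "0 \<le> u" "u \<le> 1"
  shows "L (u *\<^sub>R a + (1 - u) *\<^sub>R b) \<le> 1"
proof -
  have "L (u *\<^sub>R a + (1 - u) *\<^sub>R b) \<le> u * L a + (1 - u) * L b"
    using assms seminorm_add[OF seminorm_L, of "u *\<^sub>R a" "(1 - u) *\<^sub>R b"]
    by (simp add: seminorm_scale[OF seminorm_L])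
  also have "\<dots> \<le> 1" using assms convex_bound_le[of "L a" 1 "L b" u "1 - u"] by simp
  finally show ?thesis .
qed

lemma Lt_coset [simp]: "Lt L (coset e a) = L a"
  by (metis L_shift Lt_def rep_coset)

lemma coset_in_K [simp]: "coset e a \<in> K \<longleftrightarrow> L a \<le> 1"
  by (simp add: Kset_def)

lemma K_cases:
  assumes "C \<in> K"
  obtains a where "C = coset e a" "L a \<le> 1"
  using assms by (auto simp: Kset_def Qt_def)

lemma lsc_q':
  assumes y: "\<And>n::nat. L (y n) \<le> r" and lim: "(\<lambda>n. q_norm e (y n - a)) \<longlonglongrightarrow> 0"
  shows "L a \<le> r"
\<comment> \<open>A level \<open>s > r\<close> is positive and may be divided by, while
  \<open>r\<close> itself may be 0.\<close>
proof (rule dense_ge)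
  fix s assume "r < s"
  moreover have "0 \<le> r" using y[of 0] seminorm_nonneg[OF seminorm_L, of "y 0"] by simp
  ultimately have s: "0 < s" by simp
  have "L ((1 / s) *\<^sub>R a) \<le> 1"
  proof (rule lsc_q)
    show "L ((1 / s) *\<^sub>R y n) \<le> 1" for n
      using y[of n] s \<open>r < s\<close> by (simp add: seminorm_scale[OF seminorm_L])
    have "q_norm e ((1 / s) *\<^sub>R y n - (1 / s) *\<^sub>R a) = 1 / s * q_norm e (y n - a)" for n
      using s seminorm_scale[OF seminorm_q, of "1 / s" "y n - a"] by (simp add: algebra_simps)
    then show "(\<lambda>n. q_norm e ((1 / s) *\<^sub>R y n - (1 / s) *\<^sub>R a)) \<longlonglongrightarrow> 0"
      using tendsto_mult_right_zero[OF lim, of "1 / s"] by simp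
  qed
  then show "L a \<le> s" using s by (simp add: seminorm_scale[OF seminorm_L])
qed

text \<open>The constant sequence 0 converges to \<open>a\<close> in \<open>q_norm e\<close>, so
  lower semicontinuity at level 0 gives \<open>L a = 0\<close>. Definiteness of the quotient metric
  thus comes from \<open>L\<close>, not from the order.\<close>

lemma q_norm_eq_0D:
  assumes "q_norm e a = 0"
  shows "\<exists>t. a = t *\<^sub>R e"
proof -
  have "L a \<le> 0"
    by (rule lsc_q'[where y = "\<lambda>_. 0"])
      (simp_all add: assms seminorm_zero[OF seminorm_L] seminorm_minus[OF seminorm_q])
  then show ?thesis using kernel_L seminorm_nonneg[OF seminorm_L, of a] by simp
qed

lemma Metric_space_Qt: "Metric_space (Qt e) (qdist e)"
proof
  fix C D
  show "0 \<le> qdist e C D" by (simp add: qdist_rep seminorm_nonneg[OF seminorm_q])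
  show "qdist e C D = qdist e D C" by (simp add: qdist_rep seminorm_diff_commute[OF seminorm_q])
  fix B
  show "qdist e C B \<le> qdist e C D + qdist e D B"
    by (simp add: qdist_rep seminorm_triangle[OF seminorm_q])
next
  fix C D assume CD: "C \<in> Qt e" "D \<in> Qt e"
  show "qdist e C D = 0 \<longleftrightarrow> C = D"
  proof
    assume "qdist e C D = 0"
    then obtain t where "rep C - rep D = t *\<^sub>R e"
      using q_norm_eq_0D by (auto simp: qdist_rep)
    then have "rep C = rep D + t *\<^sub>R e" by (simp add: algebra_simps)
    then have "coset e (rep C) = coset e (rep D)" by simp
    then show "C = D" by (simp add: coset_rep CD)
  qed (simp add: qdist_rep seminorm_zero[OF seminorm_q])
qed

lemma Metric_space_K: "Metric_space K (qdist e)"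
  by (rule Metric_space.subspace[OF Metric_space_Qt]) (auto simp: Kset_def)

section \<open>Affine functions on \<open>K\<close> and their linear extensions\<close>

lemma Af0_affine:
  assumes "f \<in> Af0 e K" "C \<in> K" "D \<in> K" "0 \<le> u" "u \<le> 1"
  shows "f (qadd e (qscale e u C) (qscale e (1 - u) D)) = u * f C + (1 - u) * f D"
  using assms by (simp add: Af0_def)

lemma Af0_scale:
  assumes f: "f \<in> Af0 e K" and a: "L a \<le> 1" and u: "0 \<le> u" "u \<le> 1"
  shows "f (coset e (u *\<^sub>R a)) = u * f (coset e a)"
proof -
  have "coset e a \<in> K" "coset e 0 \<in> K" using a seminorm_zero[OF seminorm_L] by simp_all
  then have "f (qadd e (qscale e u (coset e a)) (qscale e (1 - u) (coset e 0)))
      = u * f (coset e a) + (1 - u) * f (coset e 0)"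
    using Af0_affine[OF f] u by simp
  moreover have "f (coset e 0) = 0" using f by (simp add: Af0_def qzero_def)
  ultimately show ?thesis by (simp add: qadd_coset qscale_coset)
qed

lemma Af0_midpoint:
  assumes f: "f \<in> Af0 e K" and "L a \<le> 1" "L b \<le> 1"
  shows "f (coset e ((1/2) *\<^sub>R (a + b))) = (f (coset e a) + f (coset e b)) / 2"
proof -
  have "f (qadd e (qscale e (1/2) (coset e a)) (qscale e (1 - 1/2) (coset e b)))
      = 1/2 * f (coset e a) + (1 - 1/2) * f (coset e b)"
    using assms by (intro Af0_affine) simp_all
  then show ?thesis by (simp add: qadd_coset qscale_coset scaleR_right_distrib add_divide_distrib)
qed

lemma Af0_coset_kernel:
  assumes f: "f \<in> Af0 e K" and "L a = 0"
  shows "f (coset e a) = 0"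
proof -
  obtain t where "a = 0 + t *\<^sub>R e" using assms kernel_L by auto
  then have "coset e a = coset e 0" by (simp only: coset_shift)
  then show ?thesis using f by (simp add: Af0_def qzero_def)
qed

text \<open>By homogeneity any \<open>s \<ge> L a\<close> can replace the scale \<open>L a\<close>
  of \<open>sigma\<close>; this lets two elements share one scale and covers
  \<open>L a = 0\<close>.\<close>

lemma sigma_coset:
  assumes f: "f \<in> Af0 e K" and s: "0 < s" "L a \<le> s"
  shows "sigma e L (coset e a) f = s * f (coset e ((1 / s) *\<^sub>R a))"
proof (cases "L a = 0")
  case True
  then have "L ((1 / s) *\<^sub>R a) = 0" by (simp add: seminorm_scale[OF seminorm_L])
  then show ?thesis using True Af0_coset_kernel[OF f] by (simp add: sigma_def)
next
  case False
  then have l: "0 < L a" using seminorm_nonneg[OF seminorm_L, of a] by simp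
  have "L ((1 / L a) *\<^sub>R a) \<le> 1" using l by (simp add: seminorm_scale[OF seminorm_L])
  then have "f (coset e ((L a / s) *\<^sub>R (1 / L a) *\<^sub>R a)) = L a / s * f (coset e ((1 / L a) *\<^sub>R a))"
    using s l by (intro Af0_scale[OF f]) auto
  then show ?thesis using s l by (simp add: sigma_def qscale_coset)
qed

lemma sigma_coset_K: "f \<in> Af0 e K \<Longrightarrow> L a \<le> 1 \<Longrightarrow> sigma e L (coset e a) f = f (coset e a)"
  using sigma_coset[of f 1 a] by simp

lemma sigma_add:
  assumes f: "f \<in> Af0 e K"
  shows "sigma e L (coset e (a + b)) f = sigma e L (coset e a) f + sigma e L (coset e b) f"
proof -
  \<comment> \<open>A common scale, kept positive on the kernel of \<open>L\<close> by the summand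
    1. The midpoint of \<open>a / s\<close> and \<open>b / s\<close> is
    \<open>(a + b) / (2 * s)\<close>, hence the scale \<open>2 * s\<close> for the sum.\<close>
  define s where "s = L a + L b + 1"
  have s: "0 < s" "L a \<le> s" "L b \<le> s"
    using seminorm_nonneg[OF seminorm_L, of a] seminorm_nonneg[OF seminorm_L, of b]
    by (auto simp: s_def)
  have "L ((1 / s) *\<^sub>R a) \<le> 1" "L ((1 / s) *\<^sub>R b) \<le> 1"
    using s by (simp_all add: seminorm_scale[OF seminorm_L])
  from Af0_midpoint[OF f this]
  have "f (coset e ((1 / (2 * s)) *\<^sub>R (a + b)))
      = (f (coset e ((1 / s) *\<^sub>R a)) + f (coset e ((1 / s) *\<^sub>R b))) / 2"
    by (simp add: scaleR_right_distrib)
  moreover have "L (a + b) \<le> 2 * s"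
    using s seminorm_add[OF seminorm_L, of a b] by simp
  ultimately show ?thesis
    using sigma_coset[OF f, of "2 * s" "a + b"] sigma_coset[OF f, of s a]
      sigma_coset[OF f, of s b] s by (simp add: algebra_simps)
qed

lemma sigma_scale_nonneg:
  assumes f: "f \<in> Af0 e K" and r: "0 \<le> r"
  shows "sigma e L (coset e (r *\<^sub>R a)) f = r * sigma e L (coset e a) f"
proof (cases "r = 0")
  case True
  then show ?thesis using seminorm_zero[OF seminorm_L] by (simp add: sigma_def)
next
  case False
  define s where "s = L a + 1"
  have s: "0 < s" "L a \<le> s"
    using seminorm_nonneg[OF seminorm_L, of a] by (auto simp: s_def)
  then show ?thesis
    using sigma_coset[OF f, of "r * s" "r *\<^sub>R a"] sigma_coset[OF f, of s a] r False
    by (simp add: seminorm_scale[OF seminorm_L])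
qed

lemma linear_sigma:
  assumes f: "f \<in> Af0 e K"
  shows "linear (\<lambda>a. sigma e L (coset e a) f)"
proof (rule linearI)
  fix r :: real and a
  show "sigma e L (coset e (r *\<^sub>R a)) f = r *\<^sub>R sigma e L (coset e a) f"
  proof (cases "0 \<le> r")
    case True
    then show ?thesis by (simp add: sigma_scale_nonneg[OF f])
  next
    case False
    have "sigma e L (coset e (r *\<^sub>R a + (- r) *\<^sub>R a)) f = 0"
      using seminorm_zero[OF seminorm_L] by (simp add: sigma_def)
    then show ?thesis
      using False sigma_add[OF f, of "r *\<^sub>R a" "(- r) *\<^sub>R a"] sigma_scale_nonneg[OF f, of "- r" a]
      by simp
  qed
qed (rule sigma_add[OF f])

lemma Af0_uminus:
  assumes f: "f \<in> Af0 e K" and "L a \<le> 1"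
  shows "f (coset e (- a)) = - f (coset e a)"
  using linear_neg[OF linear_sigma[OF f], of a] assms
  by (simp add: sigma_coset_K seminorm_minus[OF seminorm_L])

text \<open>The two bounds do different work: the one by \<open>L\<close> makes \<open>g\<close>
  vanish on multiples of \<open>e\<close>, so that it descends to cosets; the one by
  \<open>q_norm e\<close> makes the result continuous.\<close>

lemma Af0_of_linear:
  assumes g: "linear g" and gL: "\<And>x. \<bar>g x\<bar> \<le> L x" and gq: "\<And>x. \<bar>g x\<bar> \<le> M * q_norm e x"
  obtains f where "f \<in> Af0 e K" "\<And>a. L a \<le> 1 \<Longrightarrow> f (coset e a) = g a"
    "\<And>a. sigma e L (coset e a) f = g a"
proof -
  define f where "f C = (if C \<in> K then g (rep C) else 0)" for C
  have "g (t *\<^sub>R e) = 0" for t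
    using gL[of "t *\<^sub>R e"] kernel_L[of "t *\<^sub>R e"] by auto
  then have g_rep: "g (rep (coset e a)) = g a" for a
    by (metis add.right_neutral g linear_add rep_coset)
  then have f_coset: "f (coset e a) = g a" if "L a \<le> 1" for a
    using that by (simp add: f_def)
  have f: "f \<in> Af0 e K"
    unfolding Af0_def
  proof (intro CollectI conjI ballI allI impI)
    show "f C = 0" if "C \<notin> K" for C using that by (simp add: f_def)
    show "f (qzero e) = 0"
      using seminorm_zero[OF seminorm_L] linear_0[OF g] by (simp add: qzero_def f_coset)
  next
    fix C D and u :: real assume "C \<in> K" "D \<in> K" and u: "0 \<le> u \<and> u \<le> 1"
    then obtain a b where ab: "C = coset e a" "L a \<le> 1" "D = coset e b" "L b \<le> 1"
      by (metis K_cases)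
    then have "L (u *\<^sub>R a + (1 - u) *\<^sub>R b) \<le> 1" using u by (simp add: L_convex)
    then show "f (qadd e (qscale e u C) (qscale e (1 - u) D)) = u * f C + (1 - u) * f D"
      using ab by (simp add: qadd_coset qscale_coset f_coset linear_add[OF g] linear_scale[OF g])
  next
    fix C and \<epsilon> :: real assume C: "C \<in> K" and \<epsilon>: "0 < \<epsilon>"
    have "\<bar>f D - f C\<bar> < \<epsilon>" if D: "D \<in> K" "qdist e D C < \<epsilon> / (\<bar>M\<bar> + 1)" for D
    proof -
      have "\<bar>f D - f C\<bar> = \<bar>g (rep D - rep C)\<bar>"
        using C D by (simp add: f_def linear_diff[OF g])
      also have "\<dots> \<le> M * qdist e D C" by (simp add: gq qdist_rep)
      also have "\<dots> \<le> (\<bar>M\<bar> + 1) * qdist e D C"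
        by (intro mult_right_mono) (auto simp: qdist_rep seminorm_nonneg[OF seminorm_q])
      also have "\<dots> < \<epsilon>" using D by (simp add: pos_less_divide_eq mult.commute)
      finally show ?thesis .
    qed
    moreover have "0 < \<epsilon> / (\<bar>M\<bar> + 1)" using \<epsilon> by simp
    ultimately show "\<exists>\<delta>>0. \<forall>D\<in>K. qdist e D C < \<delta> \<longrightarrow> \<bar>f D - f C\<bar> < \<epsilon>" by blast
  qed
  show thesis
  proof (rule that[OF f f_coset])
    fix a
    define s where "s = L a + 1"
    have s: "0 < s" "L a \<le> s"
      using seminorm_nonneg[OF seminorm_L, of a] by (auto simp: s_def)
    then have "L ((1 / s) *\<^sub>R a) \<le> 1" by (simp add: seminorm_scale[OF seminorm_L])
    then show "sigma e L (coset e a) f = g a"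
      using sigma_coset[OF f s] s by (simp add: f_coset linear_scale[OF g])
  qed
qed

lemma q_convex_K: "q_convex e K"
  unfolding q_convex_def
proof (intro ballI allI impI)
  fix C D and u :: real assume "C \<in> K" "D \<in> K" and u: "0 \<le> u \<and> u \<le> 1"
  then obtain a b where ab: "C = coset e a" "L a \<le> 1" "D = coset e b" "L b \<le> 1"
    by (metis K_cases)
  then have "L (u *\<^sub>R a + (1 - u) *\<^sub>R b) \<le> 1" using u by (simp add: L_convex)
  then show "qadd e (qscale e u C) (qscale e (1 - u) D) \<in> K"
    using ab by (simp add: qadd_coset qscale_coset)
qed

end

section \<open>Duality for a compact unit ball\<close>

text \<open>The first-order condition for a minimum along a segment: \<open>A\<close> is half the
  derivative at \<open>u = 0\<close>.\<close>

lemma nonneg_of_quadratic_nonneg: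
  fixes A B :: real
  assumes B: "0 \<le> B" and quad: "\<And>u. 0 < u \<Longrightarrow> u \<le> 1 \<Longrightarrow> 0 \<le> 2 * u * A + u\<^sup>2 * B"
  shows "0 \<le> A"
proof (rule ccontr)
  assume "\<not> 0 \<le> A"
  \<comment> \<open>Chosen to give \<open>u * B \<le> - A\<close>, hence
    \<open>2 * A + u * B \<le> A < 0\<close>; the \<open>+ 1\<close> covers
    \<open>B = 0\<close>.\<close>
  define u where "u = min 1 (- A / (B + 1))"
  have u: "0 < u" "u \<le> 1" using \<open>\<not> 0 \<le> A\<close> B by (simp_all add: u_def divide_neg_pos)
  have "u * B \<le> - A / (B + 1) * (B + 1)"
    using B u by (intro mult_mono) (auto simp: u_def)
  then have "2 * A + u * B < 0" using B \<open>\<not> 0 \<le> A\<close> by simp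
  moreover have "2 * u * A + u\<^sup>2 * B = u * (2 * A + u * B)"
    by (simp add: power2_eq_square algebra_simps)
  ultimately show False using quad[OF u] u by (simp add: zero_le_mult_iff)
qed

locale compact_quotient = lsc_quotient +
  assumes compact_q: "(\<And>n::nat. L (x n) \<le> 1) \<Longrightarrow>
    \<exists>r a. strict_mono r \<and> L a \<le> 1 \<and> (\<lambda>n. q_norm e (x (r n) - a)) \<longlonglongrightarrow> 0"
begin

lemma q_compact_K: "q_compact e K"
  unfolding q_compact_def
proof (intro allI impI)
  fix X :: "nat \<Rightarrow> 'a set" assume "\<forall>n. X n \<in> K"
  then have X: "coset e (rep (X n)) = X n" "L (rep (X n)) \<le> 1" for n
    by (auto simp: Kset_def coset_rep Lt_def)
  from compact_q[of "\<lambda>n. rep (X n)", OF X(2)] obtain r a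
    where r: "strict_mono r" "L a \<le> 1" "(\<lambda>n. q_norm e (rep (X (r n)) - a)) \<longlonglongrightarrow> 0"
    by blast
  have "qdist e (X n) (coset e a) = q_norm e (rep (X n) - a)" for n
    using qdist_coset[of e "rep (X n)" a] by (simp add: X)
  then show "\<exists>r C. strict_mono r \<and> C \<in> K \<and> (\<lambda>n. qdist e (X (r n)) C) \<longlonglongrightarrow> 0"
    using r by (intro exI[of _ r] exI[of _ "coset e a"]) simp
qed

section \<open>The metric topology of \<open>K\<close> and the supremum norm\<close>

abbreviation "K_top \<equiv> Metric_space.mtopology K (qdist e)"

lemma topspace_K_top [simp]: "topspace K_top = K"
  by (rule Metric_space.topspace_mtopology[OF Metric_space_K])

lemma compact_space_K: "compact_space K_top"
proof -
  interpret K: Metric_space K "qdist e" by (rule Metric_space_K)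
  have "compactin K.mtopology K"
    unfolding K.compactin_sequentially
  proof (intro conjI allI impI)
    fix X :: "nat \<Rightarrow> 'a set" assume "range X \<subseteq> K"
    then have X: "\<forall>n. X n \<in> K" by blast
    then obtain r C where "strict_mono r" "C \<in> K" "(\<lambda>n. qdist e (X (r n)) C) \<longlonglongrightarrow> 0"
      using q_compact_K unfolding q_compact_def by blast
    then show "\<exists>l r. l \<in> K \<and> strict_mono r \<and> limitin K.mtopology (X \<circ> r) l sequentially"
      using X by (intro exI[of _ C] exI[of _ r]) (auto simp: K.limitin_metric_dist_null)
  qed simp
  then show ?thesis by (simp add: compact_space_def)
qed

lemma Af0_continuous:
  assumes f: "f \<in> Af0 e K"
  shows "continuous_map K_top euclideanreal f"
proof -
  interpret K: Metric_space K "qdist e" by (rule Metric_space_K)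
  show ?thesis
    unfolding K.continuous_map_from_metric
  proof (intro conjI ballI allI impI)
    fix C U assume C: "C \<in> K" and U: "openin euclideanreal U \<and> f C \<in> U"
    then obtain \<epsilon> where \<epsilon>: "\<epsilon> > 0" "\<And>y. \<bar>y - f C\<bar> < \<epsilon> \<Longrightarrow> y \<in> U"
      by (auto simp: open_dist dist_real_def)
    obtain \<delta> where "\<delta> > 0" "\<And>D. D \<in> K \<Longrightarrow> qdist e D C < \<delta> \<Longrightarrow> \<bar>f D - f C\<bar> < \<epsilon>"
      using f C \<epsilon>(1) unfolding Af0_def by blast
    then show "\<exists>r>0. \<forall>x. x \<in> K \<and> qdist e C x < r \<longrightarrow> f x \<in> U"
      using \<epsilon>(2) by (intro exI[of _ \<delta>]) (auto simp: K.commute)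
  qed simp
qed

lemma qzero_in_K: "qzero e \<in> K"
  using seminorm_zero[OF seminorm_L] by (simp add: qzero_def)

lemma supnorm_le: "(\<And>C. C \<in> K \<Longrightarrow> \<bar>f C\<bar> \<le> b) \<Longrightarrow> supnorm K f \<le> b"
  unfolding supnorm_def using qzero_in_K by (intro cSUP_least) auto

text \<open>\<open>Sup\<close> bounds its set only if the set is bounded above; compactness of
  \<open>K\<close> and continuity of \<open>f\<close> ensure this.\<close>

lemma abs_le_supnorm:
  assumes f: "f \<in> Af0 e K" and C: "C \<in> K"
  shows "\<bar>f C\<bar> \<le> supnorm K f"
  unfolding supnorm_def
proof (rule cSUP_upper[OF C])
  have "compactin euclideanreal (f ` K)"
    using image_compactin[OF _ Af0_continuous[OF f]] compact_space_K by (simp add: compact_space_def)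
  then have "bounded (f ` K)" by (simp add: compact_imp_bounded)
  then show "bdd_above ((\<lambda>C. \<bar>f C\<bar>) ` K)"
    by (auto simp: bounded_iff bdd_above_def)
qed

lemma abs_sigma_le:
  assumes f: "f \<in> Af0 e K"
  shows "\<bar>sigma e L (coset e a) f\<bar> \<le> L a * supnorm K f"
proof (cases "L a = 0")
  case False
  then have l: "0 < L a" using seminorm_nonneg[OF seminorm_L, of a] by simp
  have "coset e ((1 / L a) *\<^sub>R a) \<in> K" using l by (simp add: seminorm_scale[OF seminorm_L])
  from abs_le_supnorm[OF f this] show ?thesis
    using l by (simp add: sigma_def qscale_coset abs_mult)
qed (simp add: sigma_def)

lemma Af0_zero: "(\<lambda>C. 0) \<in> Af0 e K"
  by (auto simp: Af0_def intro: exI[of _ 1])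

lemma Af0_scaled:
  assumes f: "f \<in> Af0 e K"
  shows "(\<lambda>C. r * f C) \<in> Af0 e K"
  unfolding Af0_def
proof (intro CollectI conjI ballI allI impI)
  fix C D and u :: real assume "C \<in> K" "D \<in> K" "0 \<le> u \<and> u \<le> 1"
  then have "f (qadd e (qscale e u C) (qscale e (1 - u) D)) = u * f C + (1 - u) * f D"
    using Af0_affine[OF f, of C D u] by simp
  then show "r * f (qadd e (qscale e u C) (qscale e (1 - u) D)) = u * (r * f C) + (1 - u) * (r * f D)"
    by (simp only:) (simp add: algebra_simps)
next
  fix C and \<epsilon> :: real assume "C \<in> K" "0 < \<epsilon>"
  then have "0 < \<epsilon> / (\<bar>r\<bar> + 1)" by simp
  with f \<open>C \<in> K\<close> obtain \<delta>
    where \<delta>: "\<delta> > 0" "\<forall>D\<in>K. qdist e D C < \<delta> \<longrightarrow> \<bar>f D - f C\<bar> < \<epsilon> / (\<bar>r\<bar> + 1)"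
    unfolding Af0_def by blast
  have "\<bar>r * f D - r * f C\<bar> < \<epsilon>" if "D \<in> K" "qdist e D C < \<delta>" for D
  proof -
    have "\<bar>r * f D - r * f C\<bar> = \<bar>r\<bar> * \<bar>f D - f C\<bar>"
      by (simp add: right_diff_distrib[symmetric] abs_mult)
    also have "\<dots> \<le> (\<bar>r\<bar> + 1) * \<bar>f D - f C\<bar>" by (intro mult_right_mono) auto
    also have "\<dots> < \<epsilon>" using \<delta>(2) that by (simp add: pos_less_divide_eq mult.commute)
    finally show ?thesis .
  qed
  with \<delta>(1) show "\<exists>\<delta>>0. \<forall>D\<in>K. qdist e D C < \<delta> \<longrightarrow> \<bar>r * f D - r * f C\<bar> < \<epsilon>" by blast
qed (use f in \<open>auto simp: Af0_def\<close>)

lemma Af0_add: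
  assumes f: "f \<in> Af0 e K" and g: "g \<in> Af0 e K"
  shows "(\<lambda>C. f C + g C) \<in> Af0 e K"
  unfolding Af0_def
proof (intro CollectI conjI ballI allI impI)
  fix C D and u :: real assume CD: "C \<in> K" "D \<in> K" "0 \<le> u \<and> u \<le> 1"
  have "f (qadd e (qscale e u C) (qscale e (1 - u) D)) = u * f C + (1 - u) * f D"
    using Af0_affine[OF f, of C D u] CD by simp
  moreover have "g (qadd e (qscale e u C) (qscale e (1 - u) D)) = u * g C + (1 - u) * g D"
    using Af0_affine[OF g, of C D u] CD by simp
  ultimately show "f (qadd e (qscale e u C) (qscale e (1 - u) D)) +
      g (qadd e (qscale e u C) (qscale e (1 - u) D)) = u * (f C + g C) + (1 - u) * (f D + g D)"
    by (simp only:) (simp add: algebra_simps)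
next
  fix C and \<epsilon> :: real assume "C \<in> K" "0 < \<epsilon>"
  then have \<epsilon>: "0 < \<epsilon> / 2" by simp
  obtain \<delta> where \<delta>: "\<delta> > 0" "\<forall>D\<in>K. qdist e D C < \<delta> \<longrightarrow> \<bar>f D - f C\<bar> < \<epsilon> / 2"
    using f \<open>C \<in> K\<close> \<epsilon> unfolding Af0_def by blast
  obtain \<eta> where \<eta>: "\<eta> > 0" "\<forall>D\<in>K. qdist e D C < \<eta> \<longrightarrow> \<bar>g D - g C\<bar> < \<epsilon> / 2"
    using g \<open>C \<in> K\<close> \<epsilon> unfolding Af0_def by blast
  have "\<bar>f D + g D - (f C + g C)\<bar> < \<epsilon>" if "D \<in> K" "qdist e D C < min \<delta> \<eta>" for D
  proof -
    have "\<bar>f D - f C\<bar> < \<epsilon> / 2" "\<bar>g D - g C\<bar> < \<epsilon> / 2" using \<delta> \<eta> that by simp_all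
    then show ?thesis by linarith
  qed
  moreover have "0 < min \<delta> \<eta>" using \<delta> \<eta> by simp
  ultimately show "\<exists>\<delta>>0. \<forall>D\<in>K. qdist e D C < \<delta> \<longrightarrow> \<bar>f D + g D - (f C + g C)\<bar> < \<epsilon>"
    by blast
qed (use f g in \<open>auto simp: Af0_def\<close>)

section \<open>Functionals on \<open>Af0\<close> as multiples of evaluations at points of
  \<open>K\<close>\<close>

lemma dual_space_sum:
  assumes \<phi>: "\<phi> \<in> dual_space e K" and "finite I" "I \<subseteq> Af0 e K"
  shows "(\<lambda>C. \<Sum>f\<in>I. c f * f C) \<in> Af0 e K \<and> \<phi> (\<lambda>C. \<Sum>f\<in>I. c f * f C) = (\<Sum>f\<in>I. c f * \<phi> f)"
  using assms(2,3)
proof (induction I rule: finite_induct)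
  case empty
  have "\<phi> (\<lambda>C. r * f C) = r * \<phi> f" if "f \<in> Af0 e K" for f r
    using \<phi> that unfolding dual_space_def by blast
  from this[OF Af0_zero, of 0] show ?case by (simp add: Af0_zero)
next
  case (insert f I)
  then have "(\<lambda>C. c f * f C) \<in> Af0 e K" "\<phi> (\<lambda>C. c f * f C) = c f * \<phi> f"
    using \<phi> by (auto simp: Af0_scaled dual_space_def)
  moreover from this insert have
    "\<phi> (\<lambda>C. c f * f C + (\<Sum>f\<in>I. c f * f C)) = \<phi> (\<lambda>C. c f * f C) + \<phi> (\<lambda>C. \<Sum>f\<in>I. c f * f C)"
    using \<phi> by (simp add: dual_space_def)
  ultimately show ?case using insert by (simp add: Af0_add)
qed

text \<open>Helly's condition without separation in \<open>\<real>\<^sup>n\<close>: the minimiser over \<open>K\<close> of the squared error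
  solves the system exactly, because the error vector defines a functional that attains its
  norm at the minimiser.\<close>

lemma finite_representation:
  assumes \<phi>: "\<phi> \<in> dual_space e K" and bound: "\<And>f. f \<in> Af0 e K \<Longrightarrow> \<phi> f \<le> B * supnorm K f"
    and B: "0 < B" and I: "finite I" "I \<subseteq> Af0 e K"
  shows "\<exists>C\<in>K. \<forall>f\<in>I. B * f C = \<phi> f"
proof -
  define Q where "Q C = (\<Sum>f\<in>I. (B * f C - \<phi> f)\<^sup>2)" for C
  have "continuous_map K_top euclideanreal Q"
    unfolding Q_def using I
    by (auto intro!: continuous_map_sum continuous_map_real_pow continuous_map_diff
        continuous_map_real_mult intro: Af0_continuous)
  then have "compact (Q ` K)"
    using image_compactin[of K_top K euclideanreal Q] compact_space_K
    by (simp add: compact_space_def)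
  then obtain C where C: "C \<in> K" "\<And>D. D \<in> K \<Longrightarrow> Q C \<le> Q D"
    using compact_attains_inf[of "Q ` K"] qzero_in_K by auto
  \<comment> \<open>The functional given by the error vector: the derivative of \<open>Q\<close> at
    \<open>C\<close> towards \<open>D\<close> is \<open>2 * B * (g C - g D)\<close>.\<close>
  define g where "g = (\<lambda>D. \<Sum>f\<in>I. (\<phi> f - B * f C) * f D)"
  have g: "g \<in> Af0 e K" "\<phi> g = (\<Sum>f\<in>I. (\<phi> f - B * f C) * \<phi> f)"
    using dual_space_sum[OF \<phi> I, of "\<lambda>f. \<phi> f - B * f C"] by (auto simp: g_def)
  have g_max: "g D \<le> g C" if D: "D \<in> K" for D
  proof -
    define A where "A = (\<Sum>f\<in>I. (B * f C - \<phi> f) * (B * (f D - f C)))"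
    define S where "S = (\<Sum>f\<in>I. (B * (f D - f C))\<^sup>2)"
    have "0 \<le> A"
    proof (rule nonneg_of_quadratic_nonneg)
      show "0 \<le> S" by (simp add: S_def sum_nonneg)
      fix u :: real assume u: "0 < u" "u \<le> 1"
      \<comment> \<open>A point on the segment from \<open>C\<close> to \<open>D\<close>, in
        \<open>K\<close> by convexity. Minimality gives \<open>Q C \<le> Q E\<close>, and the
        expansion of \<open>Q E\<close> in \<open>u\<close> has linear coefficient
        \<open>2 * A\<close>.\<close>
      define E where "E = qadd e (qscale e u D) (qscale e (1 - u) C)"
      have "E \<in> K" using q_convex_K C D u unfolding q_convex_def E_def by simp
      have E: "f E = f C + u * (f D - f C)" if "f \<in> I" for f
      proof -
        have "f E = u * f D + (1 - u) * f C"
          using Af0_affine[of f D C u] I(2) that C D u by (auto simp: E_def)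
        then show ?thesis by (simp add: algebra_simps)
      qed
      have "Q E = (\<Sum>f\<in>I. (B * f C - \<phi> f)\<^sup>2 + (2 * u * ((B * f C - \<phi> f) * (B * (f D - f C)))
          + u\<^sup>2 * (B * (f D - f C))\<^sup>2))"
        unfolding Q_def by (intro sum.cong refl) (simp add: E power2_eq_square algebra_simps)
      also have "\<dots> = Q C + (2 * u * A + u\<^sup>2 * S)"
        by (simp add: Q_def A_def S_def sum.distrib sum_distrib_left)
      finally show "0 \<le> 2 * u * A + u\<^sup>2 * S" using C(2)[OF \<open>E \<in> K\<close>] by simp
    qed
    also have "A = B * (g C - g D)"
      unfolding A_def g_def sum_subtractf[symmetric] sum_distrib_left
      by (intro sum.cong refl) (simp add: algebra_simps)
    finally show ?thesis using B by (simp add: zero_le_mult_iff)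
  qed
  \<comment> \<open>\<open>K\<close> is symmetric, so the maximum of \<open>g\<close> also bounds
    its absolute value and \<open>supnorm K g \<le> g C\<close>.\<close>
  have "\<bar>g D\<bar> \<le> g C" if D: "D \<in> K" for D
  proof -
    obtain a where a: "D = coset e a" "L a \<le> 1" using D by (rule K_cases)
    then have "coset e (- a) \<in> K" by (simp add: seminorm_minus[OF seminorm_L])
    then show ?thesis
      using g_max[of "coset e (- a)"] g_max[OF D] Af0_uminus[OF g(1) a(2)] a by simp
  qed
  then have "\<phi> g \<le> B * g C"
    using bound[OF g(1)] supnorm_le[of g "g C"] B by (meson mult_le_cancel_left_pos order_trans)
  \<comment> \<open>The excess of \<open>\<phi> g\<close> over \<open>B * g C\<close> is the sum of
    squared errors, but the norm bound makes it at most 0.\<close>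
  moreover have "B * g C = (\<Sum>f\<in>I. B * ((\<phi> f - B * f C) * f C))"
    by (simp add: g_def sum_distrib_left)
  then have "\<phi> g - B * g C = (\<Sum>f\<in>I. (\<phi> f - B * f C)\<^sup>2)"
    unfolding g(2) by (simp only: sum_subtractf[symmetric])
      (intro sum.cong refl, simp add: power2_eq_square algebra_simps)
  ultimately have "(\<Sum>f\<in>I. (\<phi> f - B * f C)\<^sup>2) = 0"
    by (simp add: sum_nonneg antisym)
  then have "\<forall>f\<in>I. (\<phi> f - B * f C)\<^sup>2 = 0"
    using I by (subst (asm) sum_nonneg_eq_0_iff) auto
  then show ?thesis using C(1) by auto
qed

lemma sigma_surj:
  assumes \<phi>: "\<phi> \<in> dual_space e K"
  obtains a where "\<And>f. f \<in> Af0 e K \<Longrightarrow> \<phi> f = sigma e L (coset e a) f"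
proof -
  obtain B0 where B0: "\<And>f. f \<in> Af0 e K \<Longrightarrow> \<bar>\<phi> f\<bar> \<le> B0 * supnorm K f"
    using \<phi> unfolding dual_space_def by blast
  \<comment> \<open>Enlarging the bound makes it positive, so \<open>\<phi>\<close> can be sought as
    \<open>B\<close> times evaluation at a point of \<open>K\<close>.\<close>
  define B where "B = max 1 B0"
  have B: "0 < B" by (simp add: B_def)
  have bound: "\<phi> f \<le> B * supnorm K f" if f: "f \<in> Af0 e K" for f
  proof -
    have "0 \<le> supnorm K f" using abs_le_supnorm[OF f qzero_in_K] by simp
    then have "B0 * supnorm K f \<le> B * supnorm K f" by (intro mult_right_mono) (simp_all add: B_def)
    then show ?thesis using B0[OF f] by simp
  qed
  define Z where "Z f = {C \<in> K. B * f C = \<phi> f}" for f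
  \<comment> \<open>Inserting \<open>K\<close> puts the common point in \<open>K\<close> at once;
    finite subfamilies meet by \<open>finite_representation\<close>.\<close>
  have "\<Inter> (insert K (Z ` Af0 e K)) \<noteq> {}"
  proof (rule compact_space_fip[THEN iffD1, OF compact_space_K, rule_format], intro conjI ballI allI impI)
    fix S assume "S \<in> insert K (Z ` Af0 e K)"
    then consider "S = K" | f where "f \<in> Af0 e K" "S = Z f" by blast
    then show "closedin K_top S"
    proof cases
      case 1
      then show ?thesis using closedin_topspace[of K_top] by simp
    next
      case 2
      have "closedin K_top {C \<in> topspace K_top. f C \<in> {\<phi> f / B}}"
        by (rule closedin_continuous_map_preimage[OF Af0_continuous[OF 2(1)]]) simp
      moreover have "Z f = {C \<in> topspace K_top. f C \<in> {\<phi> f / B}}"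
        using B by (auto simp: Z_def field_simps)
      ultimately show ?thesis using 2 by simp
    qed
  next
    fix \<F> assume F: "finite \<F> \<and> \<F> \<subseteq> insert K (Z ` Af0 e K)"
    then have "finite (\<F> - {K})" "\<F> - {K} \<subseteq> Z ` Af0 e K" by auto
    then obtain I where I: "finite I" "I \<subseteq> Af0 e K" "\<F> - {K} = Z ` I"
      using finite_subset_image by metis
    obtain C where C: "C \<in> K" "\<forall>f\<in>I. B * f C = \<phi> f"
      using finite_representation[OF \<phi> bound B I(1,2)] by blast
    have "C \<in> S" if S: "S \<in> \<F>" for S
    proof (cases "S = K")
      case False
      then obtain f where "f \<in> I" "S = Z f" using I(3) S False by blast
      then show ?thesis using C by (simp add: Z_def)
    qed (use C in simp)
    then show "\<Inter>\<F> \<noteq> {}" by blast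
  qed
  then obtain C where C: "C \<in> K" "\<And>f. f \<in> Af0 e K \<Longrightarrow> B * f C = \<phi> f"
    by (auto simp: Z_def)
  obtain a where a: "C = coset e a" "L a \<le> 1" using C(1) by (rule K_cases)
  have "\<phi> f = sigma e L (coset e (B *\<^sub>R a)) f" if f: "f \<in> Af0 e K" for f
    using C(2)[OF f] a B sigma_coset_K[OF f a(2)] linear_scale[OF linear_sigma[OF f], of B a] by simp
  then show thesis by (rule that)
qed

lemma sigma_in_dual_space: "sigma e L (coset e a) \<in> dual_space e K"
  unfolding dual_space_def
proof (intro CollectI conjI)
  show "\<exists>B. \<forall>f\<in>Af0 e K. \<bar>sigma e L (coset e a) f\<bar> \<le> B * supnorm K f"
    using abs_sigma_le by blast
qed (simp_all add: sigma_def algebra_simps)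

lemma dual_norm_sigma: "dual_norm e K (sigma e L (coset e a)) = L a"
proof -
  define S where "S = {\<bar>sigma e L (coset e a) f\<bar> | f. f \<in> Af0 e K \<and> supnorm K f \<le> 1}"
  have upper: "s \<le> L a" if s: "s \<in> S" for s
  proof -
    obtain f where f: "s = \<bar>sigma e L (coset e a) f\<bar>" "f \<in> Af0 e K" "supnorm K f \<le> 1"
      using s unfolding S_def by blast
    have "L a * supnorm K f \<le> L a * 1"
      by (intro mult_left_mono f seminorm_nonneg[OF seminorm_L])
    then show ?thesis using abs_sigma_le[OF f(2), of a] f(1) by simp
  qed
  have "S \<noteq> {}" using Af0_zero supnorm_le[of "\<lambda>_. 0" 1] by (auto simp: S_def)
  have "Sup S = L a"
  proof (rule antisym)
    show "Sup S \<le> L a" using \<open>S \<noteq> {}\<close> upper by (rule cSup_least)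
    show "L a \<le> Sup S"
    \<comment> \<open>\<open>separating_functional\<close> reaches each value below
      \<open>L a\<close>, not \<open>L a\<close> itself.\<close>
    proof (rule dense_le)
      fix r assume "r < L a"
      then show "r \<le> Sup S"
      proof (rule separating_functional[OF seminorm_L seminorm_q, rotated])
        show "L a \<le> s" if "\<And>n. L (y n) \<le> s" "(\<lambda>n. q_norm e (y n - a)) \<longlonglongrightarrow> 0"
          for y :: "nat \<Rightarrow> 'a" and s
          using that by (rule lsc_q')
      next
        fix g M
        assume g: "linear g" "\<And>x. \<bar>g x\<bar> \<le> L x" "\<And>x. \<bar>g x\<bar> \<le> M * q_norm e x" "r \<le> g a"
        then obtain f where f: "f \<in> Af0 e K" "\<And>a. L a \<le> 1 \<Longrightarrow> f (coset e a) = g a"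
          "\<And>a. sigma e L (coset e a) f = g a"
          using Af0_of_linear by blast
        have "supnorm K f \<le> 1"
        proof (rule supnorm_le)
          fix C assume "C \<in> K"
          then show "\<bar>f C\<bar> \<le> 1" by (metis K_cases f(2) g(2) order_trans)
        qed
        then have "\<bar>g a\<bar> \<in> S" unfolding S_def using f by (intro CollectI exI[of _ f]) simp
        then have "\<bar>g a\<bar> \<le> Sup S" using upper by (intro cSup_upper bdd_aboveI)
        then show "r \<le> Sup S" using g(4) by simp
      qed
    qed
  qed
  then show ?thesis by (simp add: dual_norm_def S_def)
qed

theorem sigma_isometric_isomorphism:
  "q_compact e K \<and> q_convex e K \<and>
    (\<forall>C\<in>Qt e. sigma e L C \<in> dual_space e K) \<and>
    (\<forall>C\<in>Qt e. \<forall>D\<in>Qt e. \<forall>f\<in>Af0 e K. sigma e L (qadd e C D) f = sigma e L C f + sigma e L D f) \<and>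
    (\<forall>C\<in>Qt e. \<forall>r::real. \<forall>f\<in>Af0 e K. sigma e L (qscale e r C) f = r * sigma e L C f) \<and>
    (\<forall>C\<in>Qt e. dual_norm e K (sigma e L C) = Lt L C) \<and>
    (\<forall>\<phi>\<in>dual_space e K. \<exists>C\<in>Qt e. \<forall>f\<in>Af0 e K. \<phi> f = sigma e L C f)"
proof (intro conjI ballI allI)
  fix \<phi> assume "\<phi> \<in> dual_space e K"
  then show "\<exists>C\<in>Qt e. \<forall>f\<in>Af0 e K. \<phi> f = sigma e L C f"
    by (metis coset_in_Qt sigma_surj)
qed (auto simp: Qt_def q_compact_K q_convex_K sigma_in_dual_space qadd_coset sigma_add
    qscale_coset linear_scale[OF linear_sigma] dual_norm_sigma)

end

section \<open>Order-unit spaces\<close>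

locale order_unit =
  fixes e :: "'a::ordered_real_vector"
  assumes unit: "ou_space e" and pos: "0 \<le> e"
begin

definition bounds :: "'a \<Rightarrow> real set" where
  "bounds a = {r. 0 \<le> r \<and> - (r *\<^sub>R e) \<le> a \<and> a \<le> r *\<^sub>R e}"

lemma ou_norm_bounds: "ou_norm e a = Inf (bounds a)"
  by (simp add: ou_norm_def bounds_def)

text \<open>Positivity of \<open>e\<close> enters here: it lets the two one-sided bounds be merged,
  so that \<open>bounds a\<close> is nonempty and \<open>ou_norm\<close> a genuine infimum.\<close>

lemma scale_e_mono: "r \<le> s \<Longrightarrow> r *\<^sub>R e \<le> s *\<^sub>R e"
  by (rule scaleR_right_mono[OF _ pos])

lemma bounds_nonempty: "bounds a \<noteq> {}"
proof -
  obtain r s where "a \<le> r *\<^sub>R e" "- a \<le> s *\<^sub>R e" using unit unfolding ou_space_def by meson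
  then have "a \<le> max 0 (max r s) *\<^sub>R e" "- a \<le> max 0 (max r s) *\<^sub>R e"
    using scale_e_mono[of r "max 0 (max r s)"] scale_e_mono[of s "max 0 (max r s)"]
    by (auto intro: order_trans)
  then have "max 0 (max r s) \<in> bounds a" by (simp add: bounds_def minus_le_iff)
  then show ?thesis by blast
qed

lemma ou_norm_le: "r \<in> bounds a \<Longrightarrow> ou_norm e a \<le> r"
  unfolding ou_norm_bounds by (rule cInf_lower) (auto intro!: bdd_belowI[where m = 0] simp: bounds_def)

lemma ou_norm_nonneg: "0 \<le> ou_norm e a"
  unfolding ou_norm_bounds by (rule cInf_greatest[OF bounds_nonempty]) (simp add: bounds_def)

lemma bounds_add: "r \<in> bounds a \<Longrightarrow> s \<in> bounds b \<Longrightarrow> r + s \<in> bounds (a + b)"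
  using add_mono[of "- (r *\<^sub>R e)" a "- (s *\<^sub>R e)" b] add_mono[of a "r *\<^sub>R e" b "s *\<^sub>R e"]
  by (simp add: bounds_def algebra_simps)

lemma bounds_scale:
  assumes "r \<in> bounds a"
  shows "\<bar>c\<bar> * r \<in> bounds (c *\<^sub>R a)"
proof -
  have r: "0 \<le> r" "a \<le> r *\<^sub>R e" "- a \<le> r *\<^sub>R e"
    using assms by (auto simp: bounds_def minus_le_iff)
  have "\<bar>c\<bar> *\<^sub>R a \<le> \<bar>c\<bar> *\<^sub>R r *\<^sub>R e" "\<bar>c\<bar> *\<^sub>R (- a) \<le> \<bar>c\<bar> *\<^sub>R r *\<^sub>R e"
    by (intro scaleR_left_mono r; simp)+
  then have "c *\<^sub>R a \<le> (\<bar>c\<bar> * r) *\<^sub>R e \<and> - (c *\<^sub>R a) \<le> (\<bar>c\<bar> * r) *\<^sub>R e"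
    by (cases "0 \<le> c") auto
  then show ?thesis using r by (simp add: bounds_def minus_le_iff)
qed

lemma seminorm_ou_norm: "ou_seminorm (ou_norm e)"
proof -
  have sub: "sublinear (ou_norm e)"
  proof (rule sublinearI)
    fix x y
    show "ou_norm e (x + y) \<le> ou_norm e x + ou_norm e y"
      using le_cINF_add[OF bounds_nonempty bounds_nonempty, where f = "\<lambda>r. r" and g = "\<lambda>r. r"]
        ou_norm_le[OF bounds_add] by (simp add: ou_norm_bounds[of x] ou_norm_bounds[of y])
  next
    have "0 \<in> bounds 0" by (simp add: bounds_def)
    then show "ou_norm e 0 = 0" using ou_norm_le ou_norm_nonneg by (metis antisym)
  next
    fix r :: real and x assume r: "r > 0"
    then show "ou_norm e (r *\<^sub>R x) \<le> r * ou_norm e x"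
      using le_mult_cINF[OF bounds_nonempty r, where f = "\<lambda>r. r"] ou_norm_le[OF bounds_scale[of _ x r]]
      by (simp add: ou_norm_bounds[of x])
  qed
  have neg: "ou_norm e (- x) = ou_norm e x" for x
    unfolding ou_norm_bounds by (rule arg_cong[where f = Inf]) (auto simp: bounds_def minus_le_iff)
  show ?thesis by (rule sublinear_even_imp_seminorm[OF sub neg])
qed

section \<open>The quotient norm and the lifting of sequences\<close>

lemma q_norm_le: "q_norm e a \<le> ou_norm e (a + t *\<^sub>R e)"
  unfolding q_norm_def
  by (rule cINF_lower) (auto intro!: bdd_belowI2[where m = 0] ou_norm_nonneg)

lemma q_norm_lessE:
  assumes "q_norm e a < r"
  obtains t where "ou_norm e (a + t *\<^sub>R e) < r"
  using assms unfolding q_norm_def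
  by (subst (asm) cINF_less_iff) (auto intro!: bdd_belowI2[where m = 0] ou_norm_nonneg)

lemma seminorm_q_norm: "ou_seminorm (q_norm e)"
proof -
  have sub: "sublinear (q_norm e)"
  proof (rule sublinearI)
    fix x y
    show "q_norm e (x + y) \<le> q_norm e x + q_norm e y"
      unfolding q_norm_def[of e x] q_norm_def[of e y]
    proof (rule le_cINF_add)
      fix s t :: real
      show "q_norm e (x + y) \<le> ou_norm e (x + s *\<^sub>R e) + ou_norm e (y + t *\<^sub>R e)"
        using q_norm_le[of "x + y" "s + t"]
          seminorm_add[OF seminorm_ou_norm, of "x + s *\<^sub>R e" "y + t *\<^sub>R e"]
        by (simp add: algebra_simps)
    qed auto
  next
    have "0 \<le> q_norm e 0"
      unfolding q_norm_def by (rule cINF_greatest) (auto intro: ou_norm_nonneg)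
    then show "q_norm e 0 = 0"
      using q_norm_le[of 0 0] by (simp add: seminorm_zero[OF seminorm_ou_norm])
  next
    fix r :: real and x assume r: "r > 0"
    show "q_norm e (r *\<^sub>R x) \<le> r * q_norm e x"
      unfolding q_norm_def[of e x]
    proof (rule le_mult_cINF)
      fix t :: real
      show "q_norm e (r *\<^sub>R x) \<le> r * ou_norm e (x + t *\<^sub>R e)"
        using q_norm_le[of "r *\<^sub>R x" "r * t"] seminorm_scale[OF seminorm_ou_norm, of r "x + t *\<^sub>R e"] r
        by (simp add: algebra_simps)
    qed (use r in auto)
  qed
  have le: "q_norm e (- x) \<le> q_norm e x" for x
    unfolding q_norm_def[of e x]
  proof (rule cINF_greatest)
    fix t :: real
    show "q_norm e (- x) \<le> ou_norm e (x + t *\<^sub>R e)"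
      using q_norm_le[of "- x" "- t"] seminorm_minus[OF seminorm_ou_norm, of "x + t *\<^sub>R e"] by simp
  qed auto
  have neg: "q_norm e (- x) = q_norm e x" for x
    using le[of x] le[of "- x"] by simp
  show ?thesis by (rule sublinear_even_imp_seminorm[OF sub neg])
qed

text \<open>Shifts by multiples of \<open>e\<close> leave \<open>L\<close> unchanged, and
  near-optimal shifts turn quotient convergence into \<open>ou_norm\<close> convergence, to which
  \<open>ou_lsc\<close> applies.\<close>

lemma lsc_quotient_Lip_norm:
  assumes "Lip_norm e L"
  shows "lsc_quotient e L"
proof
  show L: "ou_seminorm L" and ker: "L a = 0 \<longleftrightarrow> (\<exists>t. a = t *\<^sub>R e)" for a
    using assms by (auto simp: Lip_norm_def)
  have lsc: "ou_lsc e L" using assms by (simp add: Lip_norm_def)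
  show "ou_seminorm (q_norm e)" by (rule seminorm_q_norm)
  fix y :: "nat \<Rightarrow> 'a" and a
  assume y: "\<And>n. L (y n) \<le> 1" and lim: "(\<lambda>n. q_norm e (y n - a)) \<longlonglongrightarrow> 0"
  have "\<exists>t. ou_norm e (y n - a + t *\<^sub>R e) < q_norm e (y n - a) + 1 / real (Suc n)" for n
    by (rule q_norm_lessE[of "y n - a" "q_norm e (y n - a) + 1 / real (Suc n)"]) auto
  then obtain t where t: "ou_norm e (y n - a + t n *\<^sub>R e) < q_norm e (y n - a) + 1 / real (Suc n)" for n
    by metis
  have "(\<lambda>n. ou_norm e ((y n + t n *\<^sub>R e) - a)) \<longlonglongrightarrow> 0"
  proof (rule tendsto_sandwich[OF _ _ tendsto_const])
    show "(\<lambda>n. q_norm e (y n - a) + 1 / real (Suc n)) \<longlonglongrightarrow> 0"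
      using tendsto_add[OF lim LIMSEQ_inverse_real_of_nat] by (simp add: inverse_eq_divide)
    show "\<forall>\<^sub>F n in sequentially. ou_norm e ((y n + t n *\<^sub>R e) - a) \<le> q_norm e (y n - a) + 1 / real (Suc n)"
      using t by (intro always_eventually allI less_imp_le) (simp add: algebra_simps)
  qed (simp add: ou_norm_nonneg)
  moreover have "L (y n + t n *\<^sub>R e) \<le> 1" for n
    using seminorm_add[OF L, of "y n" "t n *\<^sub>R e"] y[of n] ker[of "t n *\<^sub>R e"] by auto
  ultimately show "L a \<le> 1"
    using lsc[unfolded ou_lsc_def, rule_format, of "\<lambda>n. y n + t n *\<^sub>R e" a] by blast
qed

text \<open>Each consecutive difference has a shift that brings its \<open>ou_norm\<close> below the
  given bound; partial sums of these shifts correct the whole sequence coherently.\<close>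

lemma lift_Cauchy:
  assumes x: "\<And>n. q_norm e (x (Suc n) - x n) < (1/2) ^ n"
  obtains t where "\<And>m n. m \<le> n \<Longrightarrow> ou_norm e ((x n + t n *\<^sub>R e) - (x m + t m *\<^sub>R e)) \<le> 2 * (1/2) ^ m"
proof -
  have "\<exists>s. ou_norm e (x (Suc n) - x n + s *\<^sub>R e) < (1/2) ^ n" for n
    by (rule q_norm_lessE[OF x[of n]]) blast
  then obtain s where s: "ou_norm e (x (Suc n) - x n + s n *\<^sub>R e) < (1/2) ^ n" for n
    by metis
  define t where "t n = (\<Sum>k<n. s k)" for n
  define y where "y n = x n + t n *\<^sub>R e" for n
  have step: "ou_norm e (y (Suc n) - y n) < (1/2) ^ n" for n
    using s[of n] by (simp add: y_def t_def algebra_simps)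
  \<comment> \<open>The subtracted term closes the induction:
    \<open>2 * (1/2) ^ n - 2 * (1/2) ^ Suc n = (1/2) ^ n\<close>.\<close>
  have tele: "ou_norm e (y n - y m) \<le> 2 * (1/2) ^ m - 2 * (1/2) ^ n" if "m \<le> n" for m n
    using that
  proof (induction n rule: dec_induct)
    case base
    then show ?case by (simp add: seminorm_zero[OF seminorm_ou_norm])
  next
    case (step n)
    then show ?case
      using \<open>\<And>n. ou_norm e (y (Suc n) - y n) < (1/2) ^ n\<close>[of n]
        seminorm_triangle[OF seminorm_ou_norm, of "y (Suc n)" "y m" "y n"] by simp
  qed
  have "ou_norm e (y n - y m) \<le> 2 * (1/2) ^ m" if "m \<le> n" for m n
    using tele[OF that] by (rule order_trans) simp
  then show thesis by (intro that[of t]) (simp add: y_def)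
qed

lemma compact_quotient_Lip_norm:
  assumes Lip: "Lip_norm e L" and closed: "Lip_closed e L"
  shows "compact_quotient e L"
proof -
  interpret lsc_quotient e L by (rule lsc_quotient_Lip_norm[OF Lip])
  interpret Q: Metric_space "Qt e" "qdist e" by (rule Metric_space_Qt)
  have tot: "Q.mtotally_bounded K"
    unfolding Q.mtotally_bounded_def
  proof (intro allI impI)
    fix \<epsilon> :: real assume "\<epsilon> > 0"
    then obtain F where F: "finite F" "\<forall>b\<in>F. L b \<le> 1"
      "\<And>a. L a \<le> 1 \<Longrightarrow> \<exists>b\<in>F. q_norm e (a - b) < \<epsilon>"
      using Lip unfolding Lip_norm_def ou_tot_bdd_def by metis
    have "K \<subseteq> (\<Union>C\<in>coset e ` F. Q.mball C \<epsilon>)"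
    proof
      fix C assume "C \<in> K"
      then obtain a where a: "C = coset e a" "L a \<le> 1" by (rule K_cases)
      with F(3) obtain b where "b \<in> F" "q_norm e (a - b) < \<epsilon>" by blast
      then show "C \<in> (\<Union>C\<in>coset e ` F. Q.mball C \<epsilon>)"
        using a by (intro UN_I[of "coset e b"])
          (auto simp: qdist_coset seminorm_diff_commute[OF seminorm_q, of b a])
    qed
    then show "\<exists>S. finite S \<and> S \<subseteq> K \<and> K \<subseteq> (\<Union>C\<in>S. Q.mball C \<epsilon>)"
      using F by (intro exI[of _ "coset e ` F"]) auto
  qed
  show ?thesis
  proof
    fix x :: "nat \<Rightarrow> 'a" assume x: "\<And>n. L (x n) \<le> 1"
    then have "range (\<lambda>n. coset e (x n)) \<subseteq> K" by auto
    then obtain r where r: "strict_mono r" "Q.MCauchy ((\<lambda>n. coset e (x n)) \<circ> r)"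
      using tot unfolding Q.mtotally_bounded_sequentially by blast
    then have Cauchy: "\<exists>N. \<forall>m\<ge>N. \<forall>n\<ge>N. q_norm e (x (r m) - x (r n)) < \<epsilon>" if "\<epsilon> > 0" for \<epsilon>
      using that unfolding Q.MCauchy_def by (simp add: qdist_coset)
    have "\<exists>N. \<forall>m\<ge>N. \<forall>n\<ge>N. q_norm e (x (r m) - x (r n)) < (1/2) ^ k" for k
      by (rule Cauchy) simp
    then obtain N where N: "\<And>k m n. m \<ge> N k \<Longrightarrow> n \<ge> N k \<Longrightarrow> q_norm e (x (r m) - x (r n)) < (1/2) ^ k"
      by metis
    \<comment> \<open>The sum makes \<open>s\<close> nondecreasing and at least \<open>N k\<close>;
      the added \<open>k\<close> makes it strictly increasing.\<close>
    define s where "s k = (\<Sum>i\<le>k. N i) + k" for k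
    have s: "strict_mono s" by (simp add: strict_mono_Suc_iff s_def)
    have sN: "N k \<le> s k" for k by (simp add: s_def trans_le_add1 member_le_sum)
    have "q_norm e (x (r (s (Suc k))) - x (r (s k))) < (1/2) ^ k" for k
      using sN[of k] strict_mono_leD[OF s, of k "Suc k"] by (intro N) auto
    then obtain t where t: "\<And>m n. m \<le> n \<Longrightarrow>
        ou_norm e ((x (r (s n)) + t n *\<^sub>R e) - (x (r (s m)) + t m *\<^sub>R e)) \<le> 2 * (1/2) ^ m"
      using lift_Cauchy[of "\<lambda>k. x (r (s k))"] by blast
    define y where "y k = x (r (s k)) + t k *\<^sub>R e" for k
    have y: "ou_norm e (y n - y m) \<le> 2 * (1/2) ^ m" if "m \<le> n" for m n
      using t[OF that] by (simp only: y_def)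
    have "\<exists>M. \<forall>m\<ge>M. \<forall>n\<ge>M. ou_norm e (y m - y n) < \<epsilon>" if eps: "\<epsilon> > 0" for \<epsilon>
    proof -
      obtain M where M: "(1/2) ^ M < \<epsilon> / 2"
        using real_arch_pow_inv[of "\<epsilon> / 2" "1/2"] eps by auto
      have "ou_norm e (y m - y n) < \<epsilon>" if mn: "m \<ge> M" "n \<ge> M" for m n
      proof -
        have pow: "(1/2::real) ^ k \<le> (1/2) ^ M" if "M \<le> k" for k
          using that by (rule power_decreasing) simp_all
        show ?thesis
        proof (cases "m \<le> n")
          case True
          then show ?thesis
            using y[of m n] pow[OF mn(1)] M seminorm_diff_commute[OF seminorm_ou_norm, of "y m" "y n"]
            by linarith
        next
          case False
          then show ?thesis using y[of n m] pow[OF mn(2)] M by linarith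
        qed
      qed
      then show ?thesis by blast
    qed
    moreover have "L (y k) \<le> 1" for k using x by (simp add: y_def)
    ultimately obtain a where a: "L a \<le> 1" "(\<lambda>k. ou_norm e (y k - a)) \<longlonglongrightarrow> 0"
      using closed unfolding Lip_closed_def by metis
    \<comment> \<open>\<open>q_norm e\<close> ignores the shifts and is dominated by
      \<open>ou_norm e\<close>, so the unshifted subsequence converges too.\<close>
    have "(\<lambda>k. q_norm e (x (r (s k)) - a)) \<longlonglongrightarrow> 0"
    proof (rule tendsto_sandwich[OF _ _ tendsto_const a(2)])
      show "\<forall>\<^sub>F k in sequentially. 0 \<le> q_norm e (x (r (s k)) - a)"
        by (simp add: seminorm_nonneg[OF seminorm_q])
      show "\<forall>\<^sub>F k in sequentially. q_norm e (x (r (s k)) - a) \<le> ou_norm e (y k - a)"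
        using q_norm_le[of "x (r (s _)) - a" "t _"]
        by (intro always_eventually allI) (simp add: y_def algebra_simps)
    qed
    then show "\<exists>r a. strict_mono r \<and> L a \<le> 1 \<and> (\<lambda>n. q_norm e (x (r n) - a)) \<longlonglongrightarrow> 0"
      using a(1) strict_mono_o[OF r(1) s] by (intro exI[of _ "r \<circ> s"] exI[of _ a]) simp
  qed
qed

end

text \<open>The axioms of \<open>ou_space\<close> do not force \<open>0 \<le> e\<close>: they also hold for \<open>e = - u\<close> with \<open>u\<close> an
  order unit. If \<open>\<not> 0 \<le> e\<close>, then \<open>ou_norm e a\<close> is the unspecified real \<open>Inf {}\<close> for every \<open>a \<noteq> 0\<close>, and
  whatever its value, a closed Lip-norm exists only if the whole space is the span of \<open>e\<close>.\<close>

lemma compact_quotient_not_pos: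
  fixes e :: "'a::ordered_real_vector"
  assumes npos: "\<not> 0 \<le> e" and Lip: "Lip_norm e L" and closed: "Lip_closed e L"
  shows "compact_quotient e L"
proof -
  define c :: real where "c = Inf {}"
  have L: "ou_seminorm L" and ker: "\<And>a. L a = 0 \<longleftrightarrow> (\<exists>t. a = t *\<^sub>R e)"
    and lsc: "ou_lsc e L" using Lip by (auto simp: Lip_norm_def)
  have e: "e \<noteq> 0" using npos by auto
  have zero: "r = 0" if "0 \<le> r" "- (r *\<^sub>R e) \<le> r *\<^sub>R e" for r
  proof (rule ccontr)
    assume "r \<noteq> 0"
    have "0 \<le> r *\<^sub>R e + r *\<^sub>R e" using add_left_mono[OF that(2), of "r *\<^sub>R e"] by simp
    then have "0 \<le> (2 * r) *\<^sub>R e" by (simp add: scaleR_left_distrib[symmetric])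
    then have "0 \<le> (1 / (2 * r)) *\<^sub>R (2 * r) *\<^sub>R e"
      using that by (intro scaleR_nonneg_nonneg[of "1 / (2 * r)"]) simp_all
    then show False using npos \<open>r \<noteq> 0\<close> by simp
  qed
  have norm_0: "ou_norm e 0 = 0"
  proof -
    have "r = 0" if "0 \<le> r" "- (r *\<^sub>R e) \<le> 0" "0 \<le> r *\<^sub>R e" for r
      using zero[OF that(1) order_trans[OF that(2,3)]] .
    then have "{r. 0 \<le> r \<and> - (r *\<^sub>R e) \<le> 0 \<and> 0 \<le> r *\<^sub>R e} = {0}"
      by (intro equalityI subsetI) simp_all
    then show ?thesis by (simp add: ou_norm_def)
  qed
  have norm_c: "ou_norm e a = c" if "a \<noteq> 0" for a
  proof -
    have "{r. 0 \<le> r \<and> - (r *\<^sub>R e) \<le> a \<and> a \<le> r *\<^sub>R e} = {}"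
    proof (rule ccontr)
      assume "\<not> ?thesis"
      then obtain r where r: "0 \<le> r" "- (r *\<^sub>R e) \<le> a" "a \<le> r *\<^sub>R e" by blast
      then have "r = 0" using zero[OF r(1) order_trans[OF r(2,3)]] by simp
      then show False using r that by auto
    qed
    then show ?thesis by (simp only: ou_norm_def c_def)
  qed
  \<comment> \<open>If \<open>c < 0\<close>, every sequence meets the Cauchy condition of
    \<open>Lip_closed\<close>, in particular the multiples \<open>n e\<close>. Norms take only the
    values 0 and \<open>c\<close>, so a limit would equal two consecutive multiples.\<close>
  have "0 \<le> c"
  proof (rule ccontr)
    assume "\<not> 0 \<le> c"
    then have c: "c < 0" by simp
    define x where "x n = real n *\<^sub>R e" for n
    have "L (x n) \<le> 1" for n using ker[of "x n"] by (auto simp: x_def)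
    moreover have "ou_norm e (x m - x n) < \<epsilon>" if "\<epsilon> > 0" for m n \<epsilon>
      using norm_0 norm_c[of "x m - x n"] that c by (cases "x m - x n = 0") auto
    ultimately obtain a where "(\<lambda>n. ou_norm e (x n - a)) \<longlonglongrightarrow> 0"
      using closed unfolding Lip_closed_def by metis
    then have "\<forall>\<^sub>F n in sequentially. c < ou_norm e (x n - a)"
      using c by (rule order_tendstoD)
    then obtain M where "\<And>n. n \<ge> M \<Longrightarrow> c < ou_norm e (x n - a)"
      by (auto simp: eventually_sequentially)
    then have "x M - a = 0" "x (Suc M) - a = 0" using norm_c by (metis le_SucI less_irrefl order_refl)+
    then have "real M *\<^sub>R e = real (Suc M) *\<^sub>R e" by (simp add: x_def)
    then show False using e by simp
  qed
  have q_c: "q_norm e a = c" if "\<nexists>t. a = t *\<^sub>R e" for a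
  proof -
    have "a + t *\<^sub>R e \<noteq> 0" for t
    proof
      assume "a + t *\<^sub>R e = 0"
      then have "a = (- t) *\<^sub>R e" by (simp add: eq_neg_iff_add_eq_0)
      then show False using that by blast
    qed
    then show ?thesis by (simp add: q_norm_def norm_c)
  qed
  have L_0: "L a = 0" for a
  proof (rule ccontr)
    assume "L a \<noteq> 0"
    then have la: "0 < L a" using seminorm_nonneg[OF L, of a] by simp
    show False
    proof (cases "c = 0")
      case True
      \<comment> \<open>For \<open>c = 0\<close> the constant sequence 0 converges to everything,
        while the factor 2 gives \<open>L b = 2\<close>.\<close>
      define b where "b = (2 / L a) *\<^sub>R a"
      have "ou_norm e (0 - b) = 0"
        using norm_0 norm_c[of "0 - b"] True by (cases "0 - b = 0") simp_all
      then have "(\<lambda>n::nat. ou_norm e (0 - b)) \<longlonglongrightarrow> 0" by simp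
      then have "L b \<le> 1"
        using lsc[unfolded ou_lsc_def, rule_format, of "\<lambda>_. 0" b] seminorm_zero[OF L] by simp
      then show False using la by (simp add: b_def seminorm_scale[OF L])
    next
      case False
      with \<open>0 \<le> c\<close> have "0 < c" by simp
      \<comment> \<open>At radius \<open>c\<close> a net point close to \<open>a\<close> differs
        from it by a multiple of \<open>e\<close> and has the same \<open>L\<close>, so
        \<open>L\<close> would take finitely many values on its unit ball; scaling \<open>a\<close>
        yields all of \<open>[0, 1]\<close>.\<close>
      then obtain F where F: "finite F" "\<And>a. L a \<le> 1 \<Longrightarrow> \<exists>b\<in>F. q_norm e (a - b) < c"
        using Lip unfolding Lip_norm_def ou_tot_bdd_def by metis
      have "{0..1} \<subseteq> L ` F"
      proof
        fix r :: real assume r: "r \<in> {0..1}"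
        have Lr: "L ((r / L a) *\<^sub>R a) = r" using r la by (simp add: seminorm_scale[OF L])
        then obtain b where b: "b \<in> F" "q_norm e ((r / L a) *\<^sub>R a - b) < c"
          using F(2)[of "(r / L a) *\<^sub>R a"] r by auto
        then obtain t where "(r / L a) *\<^sub>R a - b = t *\<^sub>R e" using q_c by fastforce
        then have "L ((r / L a) *\<^sub>R a - b) = 0" using ker by blast
        then have "L ((r / L a) *\<^sub>R a) = L b"
          using seminorm_add[OF L, of "(r / L a) *\<^sub>R a - b" b]
            seminorm_diff[OF L, of "(r / L a) *\<^sub>R a" "(r / L a) *\<^sub>R a - b"] by simp
        then show "r \<in> L ` F" using Lr b(1) by auto
      qed
      then have "finite {0..1::real}" using F(1) finite_subset by blast
      then show False by (simp add: infinite_Icc)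
    qed
  qed
  have norm_nonneg: "0 \<le> ou_norm e a" for a
    using norm_0 norm_c[of a] \<open>0 \<le> c\<close> by (cases "a = 0") simp_all
  have q_0: "q_norm e a = 0" for a
  proof (rule antisym)
    obtain t where t: "a = t *\<^sub>R e" using L_0 ker by blast
    have "q_norm e a \<le> ou_norm e (a + (- t) *\<^sub>R e)"
      unfolding q_norm_def
      by (rule cINF_lower) (auto intro!: bdd_belowI2[where m = 0] norm_nonneg)
    then show "q_norm e a \<le> 0" by (simp add: t norm_0)
    show "0 \<le> q_norm e a"
      unfolding q_norm_def by (rule cINF_greatest) (auto intro: norm_nonneg)
  qed
  show ?thesis
  proof
    show "ou_seminorm (q_norm e)" by (simp add: ou_seminorm_def q_0)
    show "\<exists>r a. strict_mono r \<and> L a \<le> 1 \<and> (\<lambda>n. q_norm e (x (r n) - a)) \<longlonglongrightarrow> 0"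
      for x :: "nat \<Rightarrow> 'a"
      using L_0 q_0 by (intro exI[of _ id] exI[of _ 0]) (simp add: strict_mono_def)
  qed (use L ker L_0 in auto)
qed

theorem theorem5p2:
  fixes e :: "'a::ordered_real_vector" and L :: "'a \<Rightarrow> real"
  assumes "ou_space e" and "Lip_norm e L" and "Lip_closed e L"
  shows "q_compact e (Kset e L) \<and> q_convex e (Kset e L) \<and>
    (\<forall>C\<in>Qt e. sigma e L C \<in> dual_space e (Kset e L)) \<and>
    (\<forall>C\<in>Qt e. \<forall>D\<in>Qt e. \<forall>f\<in>Af0 e (Kset e L).
        sigma e L (qadd e C D) f = sigma e L C f + sigma e L D f) \<and>
    (\<forall>C\<in>Qt e. \<forall>r::real. \<forall>f\<in>Af0 e (Kset e L).
        sigma e L (qscale e r C) f = r * sigma e L C f) \<and>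
    (\<forall>C\<in>Qt e. dual_norm e (Kset e L) (sigma e L C) = Lt L C) \<and>
    (\<forall>\<phi>\<in>dual_space e (Kset e L). \<exists>C\<in>Qt e. \<forall>f\<in>Af0 e (Kset e L). \<phi> f = sigma e L C f)"
proof -
  have "compact_quotient e L"
  proof (cases "0 \<le> e")
    case True
    with assms show ?thesis
      by (intro order_unit.compact_quotient_Lip_norm) (auto simp: order_unit_def)
  next
    case False
    with assms show ?thesis by (intro compact_quotient_not_pos)
  qed
  then show ?thesis by (rule compact_quotient.sigma_isometric_isomorphism)
qed

end
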